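(* Let $G$ be a group equipped with a CCM $\mu$. Then $\operatorname{dc}_\mu(G)>0$ if and only if $G$ is finite-by-abelian-by-finite. Moreover, $\operatorname{dc}_{\mathrm{CCM}}(G):=\operatorname{dc}_\mu(G)$ is a rational number that does not depend on the choice of the CCM $\mu$ on $G$.
   Context: A coset correct mean (CCM) on a group $G$ is a function $\mu\colon \mathcal{P}(G)\to[0,1]$ with (i) $\mu(G)=1$; (ii) $\mu(A\sqcup B)=\mu(A)+\mu(B)$ for disjoint $A,B\subseteq G$; (iii) $\mu(gH)=\frac{1}{[G:H]}$ for all subgroups $H\le G$ and $g\in G$ (read as $0$ if $[G:H]=\infty$). For a finitely additive probability mean $\mu$ on $G$ and a bounded function $f\colon G\to\mathbb{R}$, $\int f\,\mathrm{d}\mu$ is the usual integral: $f\mapsto\int f\,\mathrm{d}\mu$ is the unique linear functional on the bounded functions that is monotone and satisfies $\int \mathbf{1}_A\,\mathrm{d}\mu=\mu(A)$ for all $A\subseteq G$. The product mean $\mu^{(2)}$ on $G^2=G\times G$ is $\mu^{(2)}(S)=\int \mu(S_g)\,\mathrm{d}\mu(g)$ for $S\subseteq G^2$, where $S_g=\{h\in G:(g,h)\in S\}$. Let $\operatorname{Comm}(G)=\{(g,h)\in G^2: gh=hg\}$. The degree of commutativity of $G$ with respect to $\mu$ is $\operatorname{dc}_\mu(G)=\mu^{(2)}(\operatorname{Comm}(G))$. A group $G$ is finite-by-abelian-by-finite (FAF) if it has a normal subgroup $H$ of finite index such that $H$ has a finite normal subgroup $N$ with $H/N$ abelian (equivalently,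 $G$ has a finite normal subgroup $N$ such that $G/N$ has a finite index abelian normal subgroup). *)

theory Defs
  imports Complex_Main "HOL-Algebra.Coset" "HOL-Analysis.Elementary_Metric_Spaces"
    "HOL-Library.Indicator_Function"
begin

text \<open>
  Means on a group \<open>G\<close> are functions \<^typ>\<open>'a set \<Rightarrow> real\<close> of which only the values on subsets of
  \<open>carrier G\<close> matter; likewise only the values on \<open>carrier G\<close> of functions \<^typ>\<open>'a \<Rightarrow> real\<close> matter.
\<close>

definition fin_add_mean :: "('a, 'b) monoid_scheme \<Rightarrow> ('a set \<Rightarrow> real) \<Rightarrow> bool" where
  "fin_add_mean G \<mu> \<longleftrightarrow>
     (\<forall>A. A \<subseteq> carrier G \<longrightarrow> 0 \<le> \<mu> A \<and> \<mu> A \<le> 1) \<and>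
     \<mu> (carrier G) = 1 \<and>
     (\<forall>A B. A \<subseteq> carrier G \<longrightarrow> B \<subseteq> carrier G \<longrightarrow> A \<inter> B = {} \<longrightarrow> \<mu> (A \<union> B) = \<mu> A + \<mu> B)"

definition inv_index :: "('a, 'b) monoid_scheme \<Rightarrow> 'a set \<Rightarrow> real" where
  "inv_index G H =
     (if finite (rcosets\<^bsub>G\<^esub> H) then 1 / real (card (rcosets\<^bsub>G\<^esub> H)) else 0)"

definition coset_correct_mean :: "('a, 'b) monoid_scheme \<Rightarrow> ('a set \<Rightarrow> real) \<Rightarrow> bool" where
  "coset_correct_mean G \<mu> \<longleftrightarrow>
     fin_add_mean G \<mu> \<and>
     (\<forall>H g. subgroup H G \<longrightarrow> g \<in> carrier G \<longrightarrow> \<mu> (g <#\<^bsub>G\<^esub> H) = inv_index G H)"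

definition bounded_fun_on :: "('a, 'b) monoid_scheme \<Rightarrow> ('a \<Rightarrow> real) \<Rightarrow> bool" where
  "bounded_fun_on G f \<longleftrightarrow> bounded (f ` carrier G)"

definition integral_functional ::
  "('a, 'b) monoid_scheme \<Rightarrow> ('a set \<Rightarrow> real) \<Rightarrow> (('a \<Rightarrow> real) \<Rightarrow> real) \<Rightarrow> bool" where
  "integral_functional G \<mu> I \<longleftrightarrow>
     (\<forall>f g. bounded_fun_on G f \<longrightarrow> bounded_fun_on G g \<longrightarrow> I (\<lambda>x. f x + g x) = I f + I g) \<and>
     (\<forall>c f. bounded_fun_on G f \<longrightarrow> I (\<lambda>x. c * f x) = c * I f) \<and>
     (\<forall>f g. bounded_fun_on G f \<longrightarrow> bounded_fun_on G g \<longrightarrow> (\<forall>x\<in>carrier G. f x \<le> g x) \<longrightarrow> I f \<le> I g) \<and>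
     (\<forall>A. A \<subseteq> carrier G \<longrightarrow> I (indicator A) = \<mu> A)"

text \<open>
  For a finitely additive mean \<open>\<mu>\<close>, integral functionals exist and all agree on the functions
  that are bounded on \<open>carrier G\<close>. They are unconstrained on the other functions, so the
  description below singles out the value at \<open>f\<close>, not the functional.
\<close>

definition mean_integral ::
  "('a, 'b) monoid_scheme \<Rightarrow> ('a set \<Rightarrow> real) \<Rightarrow> ('a \<Rightarrow> real) \<Rightarrow> real" where
  "mean_integral G \<mu> f = (THE r. \<exists>I. integral_functional G \<mu> I \<and> I f = r)"

definition product_mean ::
  "('a, 'b) monoid_scheme \<Rightarrow> ('a set \<Rightarrow> real) \<Rightarrow> ('a \<times> 'a) set \<Rightarrow> real" where
  "product_mean G \<mu> S = mean_integral G \<mu> (\<lambda>g. \<mu> {h \<in> carrier G. (g, h) \<in> S})"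

definition commuting_pairs :: "('a, 'b) monoid_scheme \<Rightarrow> ('a \<times> 'a) set" where
  "commuting_pairs G =
     {(g, h). g \<in> carrier G \<and> h \<in> carrier G \<and> g \<otimes>\<^bsub>G\<^esub> h = h \<otimes>\<^bsub>G\<^esub> g}"

definition degree_comm :: "('a, 'b) monoid_scheme \<Rightarrow> ('a set \<Rightarrow> real) \<Rightarrow> real" where
  "degree_comm G \<mu> = product_mean G \<mu> (commuting_pairs G)"

text \<open>The common value of \<open>degree_comm G \<mu>\<close> over all coset correct means \<open>\<mu>\<close> on \<open>G\<close>;
  unspecified if there is none.\<close>

definition degree_comm_ccm :: "('a, 'b) monoid_scheme \<Rightarrow> real" where
  "degree_comm_ccm G = (THE r. \<exists>\<mu>. coset_correct_mean G \<mu> \<and> degree_comm G \<mu> = r)"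

definition finite_by_abelian_by_finite :: "('a, 'b) monoid_scheme \<Rightarrow> bool" where
  "finite_by_abelian_by_finite G \<longleftrightarrow>
     (\<exists>H. H \<lhd> G \<and> finite (rcosets\<^bsub>G\<^esub> H) \<and>
       (\<exists>N. N \<lhd> (G\<lparr>carrier := H\<rparr>) \<and> finite N \<and> comm_group ((G\<lparr>carrier := H\<rparr>) Mod N)))"

end

theory Submission
  imports Defs "HOL-Algebra.Generated_Groups" "HOL-Algebra.Left_Coset"
begin

text \<open>
  The measure of the centralizer of \<open>g\<close> is the inverse of the number of conjugates of \<open>g\<close>, so the degree
  of commutativity is the integral of this function.

  If it is positive, then a set of positive measure consists of elements with boundedly many
  conjugates. Following Peter Neumann, a maximal finite set whose quotients have small centralizers
  shows that the elements with finitely many conjugates form a subgroup of finite index on which the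
  number of conjugates is bounded. Taking an element with the most conjugates, twice, yields a subgroup
  of finite index whose commutators lie in a finite subgroup.

  Conversely, let \<open>G\<close> be finite-by-abelian-by-finite. There are a subgroup \<open>K\<close> of finite index and a
  finite set \<open>N\<close> commuting with \<open>K\<close> such that for every \<open>g\<close> with finitely many conjugates the commutators of
  \<open>g\<close> with \<open>K\<close> form a subgroup \<open>T\<close> contained in \<open>N\<close>. The measure of the centralizer of \<open>g\<close> depends
  only on \<open>T\<close> and on which commutators of \<open>g\<close> with coset representatives of \<open>K\<close> lie in \<open>T\<close>. On a coset of
  \<open>K\<close>, requiring commutators to lie in given subgroups of \<open>N\<close> defines a coset of a subgroup or
  the empty set, so the level sets of the integrand have rational measure independent of the mean.
\<close>

section \<open>Integration against a finitely additive mean\<close>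

lemma fin_add_meanD:
  assumes "fin_add_mean G \<mu>"
  shows "A \<subseteq> carrier G \<Longrightarrow> 0 \<le> \<mu> A" "A \<subseteq> carrier G \<Longrightarrow> \<mu> A \<le> 1" "\<mu> (carrier G) = 1"
    "A \<subseteq> carrier G \<Longrightarrow> B \<subseteq> carrier G \<Longrightarrow> A \<inter> B = {} \<Longrightarrow> \<mu> (A \<union> B) = \<mu> A + \<mu> B"
  using assms unfolding fin_add_mean_def by auto

lemma fin_add_mean_empty: "fin_add_mean G \<mu> \<Longrightarrow> \<mu> {} = 0"
  using fin_add_meanD(4)[of G \<mu> "{}" "{}"] by simp

lemma fin_add_mean_UN:
  assumes m: "fin_add_mean G \<mu>" and "finite I" "\<And>i. i \<in> I \<Longrightarrow> A i \<subseteq> carrier G" "disjoint_family_on A I"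
  shows "\<mu> (\<Union>i\<in>I. A i) = (\<Sum>i\<in>I. \<mu> (A i))"
  using assms(2-4)
proof (induction I)
  case empty
  show ?case using fin_add_mean_empty[OF m] by simp
next
  case (insert i I)
  have disj: "A i \<inter> (\<Union>j\<in>I. A j) = {}" "disjoint_family_on A I"
    using insert.prems(2) insert.hyps(2) by (simp_all add: disjoint_family_on_insert Int_commute)
  have "\<mu> (\<Union>j\<in>insert i I. A j) = \<mu> (A i) + \<mu> (\<Union>j\<in>I. A j)"
    using insert.prems(1) disj(1) fin_add_meanD(4)[OF m, of "A i" "\<Union>j\<in>I. A j"] by auto
  then show ?case
    using insert.IH insert.prems(1) insert.hyps disj(2) by simp
qed

lemma fin_add_mean_mono:
  assumes m: "fin_add_mean G \<mu>" and "A \<subseteq> B" "B \<subseteq> carrier G"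
  shows "\<mu> A \<le> \<mu> B"
proof -
  have "\<mu> (A \<union> (B - A)) = \<mu> A + \<mu> (B - A)" "0 \<le> \<mu> (B - A)"
    by (intro fin_add_meanD[OF m]; use assms in blast)+
  then show ?thesis using assms(2) by (simp add: Un_absorb1)
qed

lemma fin_add_mean_Diff:
  assumes m: "fin_add_mean G \<mu>" and "A \<subseteq> B" "B \<subseteq> carrier G"
  shows "\<mu> (B - A) = \<mu> B - \<mu> A"
proof -
  have "\<mu> (A \<union> (B - A)) = \<mu> A + \<mu> (B - A)"
    by (intro fin_add_meanD[OF m]; use assms in blast)+
  then show ?thesis using assms(2) by (simp add: Un_absorb1)
qed

lemma fin_add_mean_UN_le:
  assumes m: "fin_add_mean G \<mu>" and "finite I" "\<And>i. i \<in> I \<Longrightarrow> A i \<subseteq> carrier G"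
  shows "\<mu> (\<Union>i\<in>I. A i) \<le> (\<Sum>i\<in>I. \<mu> (A i))"
  using assms(2-3)
proof (induction I)
  case empty
  show ?case using fin_add_mean_empty[OF m] by simp
next
  case (insert i I)
  let ?U = "\<Union>j\<in>I. A j"
  have "\<mu> (A i \<union> (?U - A i)) = \<mu> (A i) + \<mu> (?U - A i)"
    by (intro fin_add_meanD(4)[OF m]) (use insert in auto)
  moreover have "\<mu> (?U - A i) \<le> \<mu> ?U"
    by (intro fin_add_mean_mono[OF m]) (use insert in auto)
  ultimately show ?case using insert by simp
qed

section \<open>Functions with finitely many values\<close>

definition simple_sum :: "('a, 'b) monoid_scheme \<Rightarrow> ('a set \<Rightarrow> real) \<Rightarrow> ('a \<Rightarrow> real) \<Rightarrow> real" where
  "simple_sum G \<mu> f = (\<Sum>y\<in>f ` carrier G. y * \<mu> {x \<in> carrier G. f x = y})"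

text \<open>Each level set of \<open>f\<close> is a finite disjoint union of level sets of
  \<open>h\<close>. This allows the sum to be computed over any finer finite partition.\<close>

lemma simple_sum_comp:
  assumes m: "fin_add_mean G \<mu>" and fin: "finite (h ` carrier G)" and f: "\<And>x. x \<in> carrier G \<Longrightarrow> f x = \<phi> (h x)"
  shows "simple_sum G \<mu> f = (\<Sum>z\<in>h ` carrier G. \<phi> z * \<mu> {x \<in> carrier G. h x = z})"
proof -
  let ?Z = "h ` carrier G"
  have im: "f ` carrier G = \<phi> ` ?Z" using f by force
  have "(\<Sum>z\<in>?Z. \<phi> z * \<mu> {x \<in> carrier G. h x = z}) =
     (\<Sum>y\<in>\<phi> ` ?Z. \<Sum>z\<in>{z\<in>?Z. \<phi> z = y}. \<phi> z * \<mu> {x \<in> carrier G. h x = z})"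
    by (rule sum.group[symmetric]) (use fin in auto)
  also have "\<dots> = (\<Sum>y\<in>\<phi> ` ?Z. y * \<mu> {x \<in> carrier G. f x = y})"
  proof (rule sum.cong[OF refl])
    fix y
    have "{x \<in> carrier G. f x = y} = (\<Union>z\<in>{z\<in>?Z. \<phi> z = y}. {x \<in> carrier G. h x = z})"
      using f by auto
    moreover have "\<mu> \<dots> = (\<Sum>z\<in>{z\<in>?Z. \<phi> z = y}. \<mu> {x \<in> carrier G. h x = z})"
      by (rule fin_add_mean_UN[OF m]) (use fin in \<open>auto simp: disjoint_family_on_def\<close>)
    ultimately show "(\<Sum>z\<in>{z\<in>?Z. \<phi> z = y}. \<phi> z * \<mu> {x \<in> carrier G. h x = z})
        = y * \<mu> {x \<in> carrier G. f x = y}"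
      by (simp add: sum_distrib_left)
  qed
  finally show ?thesis unfolding simple_sum_def im by simp
qed

lemma simple_sum_cmult:
  assumes m: "fin_add_mean G \<mu>" and fin: "finite (f ` carrier G)"
  shows "simple_sum G \<mu> (\<lambda>x. c * f x) = c * simple_sum G \<mu> f"
  by (subst simple_sum_comp[OF m fin, of _ "\<lambda>y. c * y"])
    (simp_all add: simple_sum_def sum_distrib_left mult.assoc)

lemma
  assumes m: "fin_add_mean G \<mu>" and fin: "finite (f ` carrier G)" "finite (g ` carrier G)"
  shows simple_sum_add: "simple_sum G \<mu> (\<lambda>x. f x + g x) = simple_sum G \<mu> f + simple_sum G \<mu> g"
    and simple_sum_mono: "(\<And>x. x \<in> carrier G \<Longrightarrow> f x \<le> g x) \<Longrightarrow> simple_sum G \<mu> f \<le> simple_sum G \<mu> g"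
proof -
  \<comment> \<open>The values of the pair cut out a common refinement of the level sets of
    \<open>f\<close> and of \<open>g\<close>.\<close>
  let ?h = "\<lambda>x. (f x, g x)"
  have "finite (?h ` carrier G)"
    by (rule finite_subset[OF _ finite_cartesian_product[OF fin]]) auto
  note comp = simple_sum_comp[OF m this]
  have f: "simple_sum G \<mu> f = (\<Sum>z\<in>?h ` carrier G. fst z * \<mu> {x \<in> carrier G. ?h x = z})"
    and g: "simple_sum G \<mu> g = (\<Sum>z\<in>?h ` carrier G. snd z * \<mu> {x \<in> carrier G. ?h x = z})"
    by (rule comp; simp)+
  have "simple_sum G \<mu> (\<lambda>x. f x + g x) =
      (\<Sum>z\<in>?h ` carrier G. (fst z + snd z) * \<mu> {x \<in> carrier G. ?h x = z})"
    by (rule comp) simp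
  then show "simple_sum G \<mu> (\<lambda>x. f x + g x) = simple_sum G \<mu> f + simple_sum G \<mu> g"
    unfolding f g by (simp add: sum.distrib distrib_right)
  show "simple_sum G \<mu> f \<le> simple_sum G \<mu> g" if "\<And>x. x \<in> carrier G \<Longrightarrow> f x \<le> g x"
    unfolding f g using that by (intro sum_mono mult_right_mono fin_add_meanD(1)[OF m]) auto
qed

lemma simple_sum_const:
  assumes m: "fin_add_mean G \<mu>"
  shows "simple_sum G \<mu> (\<lambda>x. c) = c"
proof -
  have "carrier G \<noteq> {}" using fin_add_mean_empty[OF m] fin_add_meanD(3)[OF m] by auto
  then have "(\<lambda>x. c) ` carrier G = {c}" by auto
  then show ?thesis by (simp add: simple_sum_def fin_add_meanD(3)[OF m])
qed

lemma simple_sum_indicator: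
  assumes m: "fin_add_mean G \<mu>" and A: "A \<subseteq> carrier G"
  shows "simple_sum G \<mu> (indicator A) = \<mu> A"
proof -
  let ?h = "\<lambda>x. x \<in> A"
  have "finite (?h ` carrier G)" by (rule finite_subset[of _ UNIV]) auto
  then have "simple_sum G \<mu> (indicator A)
      = (\<Sum>z\<in>?h ` carrier G. of_bool z * \<mu> {x \<in> carrier G. ?h x = z})"
    by (rule simple_sum_comp[OF m]) (simp add: indicator_def)
  \<comment> \<open>If \<open>A\<close> is empty or the whole carrier, only one truth value occurs;
    the absent one has an empty level set of measure 0, so both can be summed over.\<close>
  also have "\<dots> = (\<Sum>z\<in>UNIV. of_bool z * \<mu> {x \<in> carrier G. ?h x = z})"
  proof (rule sum.mono_neutral_left)
    have "{x \<in> carrier G. (x \<in> A) = z} = {}" if "z \<notin> ?h ` carrier G" for z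
      using that by auto
    then show "\<forall>z\<in>UNIV - ?h ` carrier G. of_bool z * \<mu> {x \<in> carrier G. ?h x = z} = 0"
      using fin_add_mean_empty[OF m] by (metis DiffE mult_zero_right)
  qed auto
  also have "\<dots> = \<mu> {x \<in> carrier G. x \<in> A}"
    by (simp add: UNIV_bool)
  also have "{x \<in> carrier G. x \<in> A} = A"
    using A by blast
  finally show ?thesis .
qed

section \<open>Bounded functions and their uniform approximation\<close>

lemma bounded_fun_onD:
  assumes "bounded_fun_on G f"
  obtains M where "\<And>x. x \<in> carrier G \<Longrightarrow> \<bar>f x\<bar> \<le> M"
  using assms unfolding bounded_fun_on_def bounded_iff by auto

lemma bounded_fun_onI: "(\<And>x. x \<in> carrier G \<Longrightarrow> \<bar>f x\<bar> \<le> M) \<Longrightarrow> bounded_fun_on G f"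
  unfolding bounded_fun_on_def bounded_iff by auto

lemma bounded_fun_on_add:
  assumes "bounded_fun_on G f" "bounded_fun_on G g"
  shows "bounded_fun_on G (\<lambda>x. f x + g x)"
proof -
  obtain M N where "\<And>x. x \<in> carrier G \<Longrightarrow> \<bar>f x\<bar> \<le> M" "\<And>x. x \<in> carrier G \<Longrightarrow> \<bar>g x\<bar> \<le> N"
    using assms by (metis bounded_fun_onD)
  then show ?thesis by (intro bounded_fun_onI[of _ _ "M + N"]) (smt (verit))
qed

lemma bounded_fun_on_cmult:
  assumes "bounded_fun_on G f"
  shows "bounded_fun_on G (\<lambda>x. c * f x)"
proof -
  obtain M where "\<And>x. x \<in> carrier G \<Longrightarrow> \<bar>f x\<bar> \<le> M"
    using assms by (metis bounded_fun_onD)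
  then show ?thesis by (intro bounded_fun_onI[of _ _ "\<bar>c\<bar> * M"]) (simp add: abs_mult mult_left_mono)
qed

lemma bounded_fun_on_simple_approx:
  assumes "bounded_fun_on G f" and "e > 0"
  obtains s where "finite (s ` carrier G)" "\<And>x. \<bar>f x - s x\<bar> \<le> e"
proof -
  obtain M where M: "\<And>x. x \<in> carrier G \<Longrightarrow> \<bar>f x\<bar> \<le> M" using assms bounded_fun_onD by blast
  \<comment> \<open>Values are rounded down to multiples of \<open>e\<close>, of which a bounded
    function meets only finitely many.\<close>
  define s where "s x = e * of_int \<lfloor>f x / e\<rfloor>" for x
  have "s ` carrier G \<subseteq> (\<lambda>k. e * of_int k) ` {\<lfloor>- M / e\<rfloor>..\<lfloor>M / e\<rfloor>}"
  proof
    fix y assume "y \<in> s ` carrier G"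
    then obtain x where "x \<in> carrier G" "y = e * of_int \<lfloor>f x / e\<rfloor>" unfolding s_def by blast
    moreover have "- M \<le> f x" "f x \<le> M" using M[OF \<open>x \<in> carrier G\<close>] by auto
    then have "\<lfloor>- M / e\<rfloor> \<le> \<lfloor>f x / e\<rfloor>" "\<lfloor>f x / e\<rfloor> \<le> \<lfloor>M / e\<rfloor>"
      using \<open>e > 0\<close> by (intro floor_mono divide_right_mono; simp)+
    ultimately show "y \<in> (\<lambda>k. e * of_int k) ` {\<lfloor>- M / e\<rfloor>..\<lfloor>M / e\<rfloor>}" by auto
  qed
  then have "finite (s ` carrier G)" by (rule finite_subset) simp
  moreover have "\<bar>f x - s x\<bar> \<le> e" for x
  proof -
    have "f x - s x = e * (f x / e - of_int \<lfloor>f x / e\<rfloor>)"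
      using \<open>e > 0\<close> by (simp add: s_def algebra_simps)
    moreover have "0 \<le> f x / e - of_int \<lfloor>f x / e\<rfloor>" "f x / e - of_int \<lfloor>f x / e\<rfloor> \<le> 1"
      by linarith+
    ultimately show ?thesis using \<open>e > 0\<close> by (simp add: abs_mult)
  qed
  ultimately show ?thesis using that by blast
qed

section \<open>Existence of an integral functional\<close>

text \<open>Serves as the witness that an integral functional exists, on which the description in
  \<open>mean_integral\<close> depends.\<close>

definition lower_integral :: "('a, 'b) monoid_scheme \<Rightarrow> ('a set \<Rightarrow> real) \<Rightarrow> ('a \<Rightarrow> real) \<Rightarrow> real" where
  "lower_integral G \<mu> f =
     Sup {simple_sum G \<mu> s |s. finite (s ` carrier G) \<and> (\<forall>x\<in>carrier G. s x \<le> f x)}"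

text \<open>Shifting \<open>s\<close> down by \<open>e\<close> gives a competitor in the supremum,
  and every competitor lies below \<open>s\<close> shifted up by \<open>e\<close>. Identities for
  \<open>lower_integral\<close> thus reduce to \<open>simple_sum\<close> up to a small
  error.\<close>

lemma lower_integral_bounds:
  assumes m: "fin_add_mean G \<mu>" and fin: "finite (s ` carrier G)"
    and close: "\<And>x. x \<in> carrier G \<Longrightarrow> \<bar>f x - s x\<bar> \<le> e"
  shows "bdd_above {simple_sum G \<mu> s |s. finite (s ` carrier G) \<and> (\<forall>x\<in>carrier G. s x \<le> f x)}"
    "\<bar>lower_integral G \<mu> f - simple_sum G \<mu> s\<bar> \<le> e"
proof -
  let ?S = "{simple_sum G \<mu> s |s. finite (s ` carrier G) \<and> (\<forall>x\<in>carrier G. s x \<le> f x)}"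
  have shift: "simple_sum G \<mu> (\<lambda>x. s x + c) = simple_sum G \<mu> s + c" "finite ((\<lambda>x. s x + c) ` carrier G)" for c
  proof -
    show "simple_sum G \<mu> (\<lambda>x. s x + c) = simple_sum G \<mu> s + c"
      using fin by (subst simple_sum_add[OF m]) (auto simp: simple_sum_const[OF m] image_constant_conv)
    show "finite ((\<lambda>x. s x + c) ` carrier G)"
      using finite_imageI[OF fin, of "\<lambda>y. y + c"] by (simp add: image_image)
  qed
  have upper: "y \<le> simple_sum G \<mu> s + e" if y: "y \<in> ?S" for y
  proof -
    obtain u where u: "y = simple_sum G \<mu> u" "finite (u ` carrier G)" "\<forall>x\<in>carrier G. u x \<le> f x"
      using y by blast
    have "u x \<le> s x + e" if "x \<in> carrier G" for x
      using close[OF that] u(3) that by (smt (verit))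
    then have "simple_sum G \<mu> u \<le> simple_sum G \<mu> (\<lambda>x. s x + e)"
      by (intro simple_sum_mono[OF m u(2) shift(2)]) auto
    then show ?thesis by (simp add: u shift)
  qed
  then show bdd: "bdd_above ?S" by (rule bdd_aboveI)
  have "s x + (- e) \<le> f x" if "x \<in> carrier G" for x
    using close[OF that] by linarith
  then have mem: "simple_sum G \<mu> (\<lambda>x. s x + (- e)) \<in> ?S"
    using shift(2) by blast
  then have "simple_sum G \<mu> s - e \<le> Sup ?S"
    using cSup_upper[OF mem bdd] unfolding shift by simp
  moreover have "Sup ?S \<le> simple_sum G \<mu> s + e"
    by (rule cSup_least[OF _ upper]) (use mem in blast)
  ultimately show "\<bar>lower_integral G \<mu> f - simple_sum G \<mu> s\<bar> \<le> e"
    unfolding lower_integral_def by linarith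
qed

lemma eq_if_arbitrarily_close:
  fixes a b c :: real
  assumes "\<And>e. e > 0 \<Longrightarrow> \<bar>a - b\<bar> \<le> c * e"
  shows "a = b"
proof (rule ccontr)
  assume "a \<noteq> b"
  then have pos: "0 < \<bar>a - b\<bar>" by simp
  \<comment> \<open>This choice of \<open>e\<close> makes the bound at most half of the distance;
    the added 1 keeps the denominator positive when \<open>c\<close> is 0.\<close>
  have "\<bar>a - b\<bar> \<le> c * (\<bar>a - b\<bar> / (2 * (\<bar>c\<bar> + 1)))"
    by (rule assms) (use pos in simp)
  also have "\<dots> \<le> (\<bar>c\<bar> + 1) * (\<bar>a - b\<bar> / (2 * (\<bar>c\<bar> + 1)))"
    by (rule mult_right_mono) auto
  also have "\<dots> = \<bar>a - b\<bar> / 2" by (simp add: field_simps)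
  finally show False using pos by simp
qed

text \<open>Additivity and homogeneity pass over from simple functions by approximation.
  Monotonicity is direct: a larger function admits more competitors in the supremum.\<close>

lemma integral_functional_lower_integral:
  assumes m: "fin_add_mean G \<mu>"
  shows "integral_functional G \<mu> (lower_integral G \<mu>)"
  unfolding integral_functional_def
proof (intro conjI allI impI)
  fix f g assume f: "bounded_fun_on G f" and g: "bounded_fun_on G g"
  show "lower_integral G \<mu> (\<lambda>x. f x + g x) = lower_integral G \<mu> f + lower_integral G \<mu> g"
  proof (rule eq_if_arbitrarily_close[of _ _ 4])
    fix e :: real assume "e > 0"
    obtain s where s: "finite (s ` carrier G)" "\<And>x. \<bar>f x - s x\<bar> \<le> e"
      using bounded_fun_on_simple_approx[OF f \<open>e > 0\<close>] by blast
    obtain t where t: "finite (t ` carrier G)" "\<And>x. \<bar>g x - t x\<bar> \<le> e"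
      using bounded_fun_on_simple_approx[OF g \<open>e > 0\<close>] by blast
    have fin: "finite ((\<lambda>x. s x + t x) ` carrier G)"
      by (rule finite_subset[of _ "(\<lambda>(a, b). a + b) ` (s ` carrier G \<times> t ` carrier G)"]) (use s t in auto)
    have "\<bar>(f x + g x) - (s x + t x)\<bar> \<le> 2 * e" for x
      using s(2)[of x] t(2)[of x] by linarith
    from lower_integral_bounds(2)[OF m fin, OF this]
    have "\<bar>lower_integral G \<mu> (\<lambda>x. f x + g x) - (simple_sum G \<mu> s + simple_sum G \<mu> t)\<bar> \<le> 2 * e"
      by (simp add: simple_sum_add[OF m s(1) t(1)])
    moreover have "\<bar>lower_integral G \<mu> f - simple_sum G \<mu> s\<bar> \<le> e"
      by (rule lower_integral_bounds(2)[OF m s(1) s(2)])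
    moreover have "\<bar>lower_integral G \<mu> g - simple_sum G \<mu> t\<bar> \<le> e"
      by (rule lower_integral_bounds(2)[OF m t(1) t(2)])
    ultimately show "\<bar>lower_integral G \<mu> (\<lambda>x. f x + g x) - (lower_integral G \<mu> f + lower_integral G \<mu> g)\<bar>
        \<le> 4 * e"
      by linarith
  qed
next
  fix c f assume f: "bounded_fun_on G f"
  show "lower_integral G \<mu> (\<lambda>x. c * f x) = c * lower_integral G \<mu> f"
  proof (rule eq_if_arbitrarily_close[of _ _ "2 * \<bar>c\<bar>"])
    fix e :: real assume "e > 0"
    obtain s where s: "finite (s ` carrier G)" "\<And>x. \<bar>f x - s x\<bar> \<le> e"
      using bounded_fun_on_simple_approx[OF f \<open>e > 0\<close>] by blast
    have fin: "finite ((\<lambda>x. c * s x) ` carrier G)"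
      using finite_imageI[OF s(1), of "\<lambda>y. c * y"] by (simp add: image_image)
    have "\<bar>c * f x - c * s x\<bar> \<le> \<bar>c\<bar> * e" for x
      using mult_left_mono[OF s(2)[of x], of "\<bar>c\<bar>"] by (simp flip: abs_mult right_diff_distrib)
    from lower_integral_bounds(2)[OF m fin, OF this]
    have "\<bar>lower_integral G \<mu> (\<lambda>x. c * f x) - c * simple_sum G \<mu> s\<bar> \<le> \<bar>c\<bar> * e"
      by (simp add: simple_sum_cmult[OF m s(1)])
    moreover have "\<bar>lower_integral G \<mu> f - simple_sum G \<mu> s\<bar> \<le> e"
      by (rule lower_integral_bounds(2)[OF m s(1) s(2)])
    then have "\<bar>c * lower_integral G \<mu> f - c * simple_sum G \<mu> s\<bar> \<le> \<bar>c\<bar> * e"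
      unfolding right_diff_distrib[symmetric] abs_mult by (rule mult_left_mono) simp
    ultimately show "\<bar>lower_integral G \<mu> (\<lambda>x. c * f x) - c * lower_integral G \<mu> f\<bar> \<le> 2 * \<bar>c\<bar> * e"
      by linarith
  qed
next
  fix f g assume f: "bounded_fun_on G f" and g: "bounded_fun_on G g" and le: "\<forall>x\<in>carrier G. f x \<le> g x"
  \<comment> \<open>Approximation within 1 is enough here: it shows one family of competitors to be
    nonempty and the other to be bounded above.\<close>
  obtain s where s: "finite (s ` carrier G)" "\<And>x. \<bar>f x - s x\<bar> \<le> 1"
    using bounded_fun_on_simple_approx[OF f zero_less_one] by blast
  obtain t where t: "finite (t ` carrier G)" "\<And>x. \<bar>g x - t x\<bar> \<le> 1"
    using bounded_fun_on_simple_approx[OF g zero_less_one] by blast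
  have fin: "finite ((\<lambda>x. s x + (- 1)) ` carrier G)"
    using finite_imageI[OF s(1), of "\<lambda>y. y + (- 1)"] by (simp add: image_image)
  have below: "s x + (- 1) \<le> f x" for x using s(2)[of x] by linarith
  show "lower_integral G \<mu> f \<le> lower_integral G \<mu> g"
    unfolding lower_integral_def
  proof (rule cSup_subset_mono)
    show "{simple_sum G \<mu> s |s. finite (s ` carrier G) \<and> (\<forall>x\<in>carrier G. s x \<le> f x)} \<noteq> {}"
      using fin below by blast
    show "bdd_above {simple_sum G \<mu> s |s. finite (s ` carrier G) \<and> (\<forall>x\<in>carrier G. s x \<le> g x)}"
      by (rule lower_integral_bounds(1)[OF m t(1) t(2)])
    show "{simple_sum G \<mu> s |s. finite (s ` carrier G) \<and> (\<forall>x\<in>carrier G. s x \<le> f x)}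
        \<subseteq> {simple_sum G \<mu> s |s. finite (s ` carrier G) \<and> (\<forall>x\<in>carrier G. s x \<le> g x)}"
    proof (rule subsetI)
      fix y assume "y \<in> {simple_sum G \<mu> s |s. finite (s ` carrier G) \<and> (\<forall>x\<in>carrier G. s x \<le> f x)}"
      then obtain u where u: "y = simple_sum G \<mu> u" "finite (u ` carrier G)" "\<forall>x\<in>carrier G. u x \<le> f x"
        by blast
      have "\<forall>x\<in>carrier G. u x \<le> g x" using u(3) le by (blast intro: order_trans)
      with u(1,2) show "y \<in> {simple_sum G \<mu> s |s. finite (s ` carrier G) \<and> (\<forall>x\<in>carrier G. s x \<le> g x)}"
        by blast
    qed
  qed
next
  fix A assume A: "A \<subseteq> carrier G"
  \<comment> \<open>An indicator is its own simple approximation, with error 0.\<close>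
  have "finite ((indicator A :: _ \<Rightarrow> real) ` carrier G)"
    by (rule finite_subset[of _ "{0, 1}"]) (auto simp: indicator_def)
  then have "\<bar>lower_integral G \<mu> (indicator A) - simple_sum G \<mu> (indicator A)\<bar> \<le> 0"
    by (rule lower_integral_bounds(2)[OF m]) simp
  then show "lower_integral G \<mu> (indicator A) = \<mu> A"
    unfolding simple_sum_indicator[OF m A] by simp
qed

text \<open>Some integral functional exists, so a value shared by all of them is the one described.
  Uniqueness is checked only at the function at hand.\<close>

lemma mean_integral_eqI:
  assumes m: "fin_add_mean G \<mu>" and val: "\<And>I. integral_functional G \<mu> I \<Longrightarrow> I f = r"
  shows "mean_integral G \<mu> f = r"
  unfolding mean_integral_def
  using integral_functional_lower_integral[OF m] val by (intro the_equality) auto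

lemma integral_functionalD:
  assumes "integral_functional G \<mu> I"
  shows "bounded_fun_on G f \<Longrightarrow> bounded_fun_on G g \<Longrightarrow> I (\<lambda>x. f x + g x) = I f + I g"
    "bounded_fun_on G f \<Longrightarrow> I (\<lambda>x. c * f x) = c * I f"
    "bounded_fun_on G f \<Longrightarrow> bounded_fun_on G g \<Longrightarrow> (\<And>x. x \<in> carrier G \<Longrightarrow> f x \<le> g x) \<Longrightarrow> I f \<le> I g"
    "A \<subseteq> carrier G \<Longrightarrow> I (indicator A) = \<mu> A"
  using assms unfolding integral_functional_def by auto

lemma bounded_fun_on_indicator: "bounded_fun_on G (indicator A)"
  by (rule bounded_fun_onI[of _ _ 1]) (simp add: indicator_def)

lemma bounded_fun_on_simple:
  assumes "finite J"
  shows "bounded_fun_on G (\<lambda>x. \<Sum>j\<in>J. c j * indicator (A j) x)"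
  using assms
  by (induction J) (auto intro: bounded_fun_onI[of _ _ 0] intro!: bounded_fun_on_add bounded_fun_on_cmult bounded_fun_on_indicator)

text \<open>Linearity and the values on indicators suffice; the sets \<open>A j\<close> may
  overlap.\<close>

lemma integral_functional_simple:
  assumes I: "integral_functional G \<mu> I" and J: "finite J" "\<And>j. j \<in> J \<Longrightarrow> A j \<subseteq> carrier G"
    and f: "\<And>x. x \<in> carrier G \<Longrightarrow> f x = (\<Sum>j\<in>J. c j * indicator (A j) x)"
  shows "I f = (\<Sum>j\<in>J. c j * \<mu> (A j))"
proof -
  note D = integral_functionalD[OF I]
  let ?s = "\<lambda>x. \<Sum>j\<in>J. c j * indicator (A j) x"
  have b: "bounded_fun_on G ?s" using J(1) by (rule bounded_fun_on_simple)
  then obtain M where "\<And>x. x \<in> carrier G \<Longrightarrow> \<bar>?s x\<bar> \<le> M" using bounded_fun_onD by blast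
  then have b': "bounded_fun_on G f" by (intro bounded_fun_onI[of _ _ M]) (simp add: f)
  \<comment> \<open>Monotonicity in both directions shows that values off the carrier do not
    matter.\<close>
  have "I f = I ?s"
    by (intro antisym D(3) b b') (simp_all add: f)
  also have "I ?s = (\<Sum>j\<in>J. c j * \<mu> (A j))"
    using J
  proof (induction J)
    case empty
    show ?case using D(2)[OF bounded_fun_on_indicator, of 0 "{}"] by simp
  next
    case (insert j J)
    then show ?case
      by (simp add: D(1) D(2) D(4) bounded_fun_on_cmult bounded_fun_on_indicator bounded_fun_on_simple)
  qed
  finally show ?thesis .
qed

lemma mean_integral_simple:
  assumes "fin_add_mean G \<mu>" "finite J" "\<And>j. j \<in> J \<Longrightarrow> A j \<subseteq> carrier G"
    and "\<And>x. x \<in> carrier G \<Longrightarrow> f x = (\<Sum>j\<in>J. c j * indicator (A j) x)"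
  shows "mean_integral G \<mu> f = (\<Sum>j\<in>J. c j * \<mu> (A j))"
  by (rule mean_integral_eqI[OF assms(1)], rule integral_functional_simple[OF _ assms(2-4)])

text \<open>As \<open>f\<close> is at most 1, it lies below \<open>e\<close> plus the indicator of
  the set where it reaches \<open>e\<close>, and that set is null.\<close>

lemma mean_integral_null:
  assumes m: "fin_add_mean G \<mu>" and f: "\<And>x. x \<in> carrier G \<Longrightarrow> 0 \<le> f x \<and> f x \<le> 1"
    and null: "\<And>e. e > 0 \<Longrightarrow> \<mu> {x \<in> carrier G. e \<le> f x} = 0"
  shows "mean_integral G \<mu> f = 0"
proof (rule mean_integral_eqI[OF m])
  fix I assume I: "integral_functional G \<mu> I"
  note D = integral_functionalD[OF I]
  have b: "bounded_fun_on G f" using f by (intro bounded_fun_onI[of _ _ 1]) auto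
  have "I (\<lambda>x. 0) = 0" using D(2)[OF b, of 0] by simp
  moreover have "I (\<lambda>x. 0) \<le> I f"
    by (rule D(3)) (use f b in \<open>auto intro: bounded_fun_onI[of _ _ 0]\<close>)
  moreover have "I f \<le> e" if "e > 0" for e
  proof -
    let ?Z = "{x \<in> carrier G. e \<le> f x}"
    let ?g = "\<lambda>x. e * indicator (carrier G) x + indicator ?Z x"
    have bs: "bounded_fun_on G (\<lambda>x. e * indicator (carrier G) x)"
      by (intro bounded_fun_on_cmult bounded_fun_on_indicator)
    have "I f \<le> I ?g"
    proof (rule D(3)[OF b bounded_fun_on_add[OF bs bounded_fun_on_indicator]])
      fix x assume "x \<in> carrier G"
      then show "f x \<le> ?g x"
        using f[of x] that by (cases "e \<le> f x") auto
    qed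
    also have "\<dots> = e * \<mu> (carrier G) + \<mu> ?Z"
      using bs by (simp add: D(1,2,4) bounded_fun_on_indicator)
    also have "\<dots> = e" using null[OF that] fin_add_meanD(3)[OF m] by simp
    finally show ?thesis .
  qed
  ultimately show "I f = 0"
    by (metis field_le_epsilon add_0 antisym)
qed

section \<open>Centralizers, commutators and subgroups of finite index\<close>

definition centralizer :: "('a, 'b) monoid_scheme \<Rightarrow> 'a set \<Rightarrow> 'a set" where
  "centralizer G A = {h \<in> carrier G. \<forall>a\<in>A. a \<otimes>\<^bsub>G\<^esub> h = h \<otimes>\<^bsub>G\<^esub> a}"

text \<open>Counts left cosets because coset correctness is about them; \<open>inv_index\<close>
  counts right cosets, and \<open>finite_rcosets_iff_lcosets\<close> connects the two.\<close>

definition finite_index :: "('a, 'b) monoid_scheme \<Rightarrow> 'a set \<Rightarrow> bool" where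
  "finite_index G H \<longleftrightarrow> subgroup H G \<and> finite (lcosets\<^bsub>G\<^esub> H)"

definition conj_by :: "('a, 'b) monoid_scheme \<Rightarrow> 'a \<Rightarrow> 'a \<Rightarrow> 'a" where
  "conj_by G l g = l \<otimes>\<^bsub>G\<^esub> g \<otimes>\<^bsub>G\<^esub> inv\<^bsub>G\<^esub> l"

text \<open>This is the commutator of \<open>inv g\<close> and \<open>l\<close>, normalised so that
  \<open>conj_by G l g\<close> is \<open>g\<close> times it. For fixed \<open>g\<close>, commutators
  therefore correspond to conjugates.\<close>

definition cmt :: "('a, 'b) monoid_scheme \<Rightarrow> 'a \<Rightarrow> 'a \<Rightarrow> 'a" where
  "cmt G g l = inv\<^bsub>G\<^esub> g \<otimes>\<^bsub>G\<^esub> conj_by G l g"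

context group
begin

section \<open>Conjugation as a group action\<close>

lemma inv_cancel [simp]:
  "x \<in> carrier G \<Longrightarrow> y \<in> carrier G \<Longrightarrow> inv x \<otimes> (x \<otimes> y) = y"
  "x \<in> carrier G \<Longrightarrow> y \<in> carrier G \<Longrightarrow> x \<otimes> (inv x \<otimes> y) = y"
  by (simp_all flip: m_assoc)

lemmas group_simps = m_assoc inv_mult_group conj_by_def cmt_def

lemma conj_by_closed [simp]: "l \<in> carrier G \<Longrightarrow> g \<in> carrier G \<Longrightarrow> conj_by G l g \<in> carrier G"
  by (simp add: conj_by_def)

lemma cmt_closed [simp]: "l \<in> carrier G \<Longrightarrow> g \<in> carrier G \<Longrightarrow> cmt G g l \<in> carrier G"
  by (simp add: cmt_def)

lemma conj_by_eq_cmt: "l \<in> carrier G \<Longrightarrow> g \<in> carrier G \<Longrightarrow> conj_by G l g = g \<otimes> cmt G g l"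
  by (simp add: cmt_def)

lemma conj_by_mult:
  "l \<in> carrier G \<Longrightarrow> m \<in> carrier G \<Longrightarrow> g \<in> carrier G \<Longrightarrow> conj_by G (l \<otimes> m) g = conj_by G l (conj_by G m g)"
  "l \<in> carrier G \<Longrightarrow> g \<in> carrier G \<Longrightarrow> h \<in> carrier G \<Longrightarrow> conj_by G l (g \<otimes> h) = conj_by G l g \<otimes> conj_by G l h"
  by (simp_all add: group_simps)

lemma conj_by_inv: "l \<in> carrier G \<Longrightarrow> g \<in> carrier G \<Longrightarrow> conj_by G l (inv g) = inv (conj_by G l g)"
  by (simp add: group_simps)

lemma conj_by_one: "g \<in> carrier G \<Longrightarrow> conj_by G \<one> g = g"
  by (simp add: conj_by_def)

lemma centralizerD:
  "h \<in> centralizer G A \<Longrightarrow> h \<in> carrier G"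
  "h \<in> centralizer G A \<Longrightarrow> a \<in> A \<Longrightarrow> a \<otimes> h = h \<otimes> a"
  unfolding centralizer_def by auto

lemma commutes_iff_conj_by:
  assumes "g \<in> carrier G" "h \<in> carrier G"
  shows "g \<otimes> h = h \<otimes> g \<longleftrightarrow> conj_by G h g = g"
proof
  assume "g \<otimes> h = h \<otimes> g"
  then have "conj_by G h g = g \<otimes> h \<otimes> inv h" by (simp add: conj_by_def)
  then show "conj_by G h g = g" using assms by (simp add: group_simps)
next
  assume "conj_by G h g = g"
  then have "g \<otimes> h = conj_by G h g \<otimes> h" by simp
  then show "g \<otimes> h = h \<otimes> g" using assms by (simp add: group_simps)
qed

lemma mem_centralizer_iff:
  "A \<subseteq> carrier G \<Longrightarrow> h \<in> centralizer G A \<longleftrightarrow> h \<in> carrier G \<and> (\<forall>a\<in>A. conj_by G h a = a)"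
  unfolding centralizer_def using commutes_iff_conj_by by (auto simp: subset_iff)

lemma mem_centralizer_singleton_iff:
  "g \<in> carrier G \<Longrightarrow> h \<in> centralizer G {g} \<longleftrightarrow> h \<in> carrier G \<and> conj_by G h g = g"
  using mem_centralizer_iff[of "{g}"] by auto

text \<open>The orbit-stabilizer correspondence: conjugates of \<open>g\<close> match left cosets of
  its centralizer.\<close>

lemma conj_by_eq_iff:
  assumes "x \<in> carrier G" "y \<in> carrier G" "g \<in> carrier G"
  shows "conj_by G x g = conj_by G y g \<longleftrightarrow> inv x \<otimes> y \<in> centralizer G {g}"
proof -
  have "conj_by G x g = conj_by G y g \<longleftrightarrow> conj_by G (inv x) (conj_by G x g) = conj_by G (inv x) (conj_by G y g)"
    using assms by (metis conj_by_closed conj_by_mult(1) conj_by_one inv_closed r_inv)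
  also have "\<dots> \<longleftrightarrow> g = conj_by G (inv x \<otimes> y) g"
    using assms by (simp add: conj_by_one flip: conj_by_mult(1))
  finally show ?thesis using assms by (auto simp: mem_centralizer_singleton_iff)
qed

lemma subgroup_centralizer:
  assumes A: "A \<subseteq> carrier G"
  shows "subgroup (centralizer G A) G"
proof (rule subgroupI)
  show "centralizer G A \<subseteq> carrier G" by (auto simp: centralizer_def)
  have "\<one> \<in> centralizer G A" using A by (auto simp: centralizer_def)
  then show "centralizer G A \<noteq> {}" by blast
next
  fix a assume a: "a \<in> centralizer G A"
  have "conj_by G (inv a) b = b" if "b \<in> A" for b
  proof -
    have "b \<in> carrier G" "a \<in> carrier G" "conj_by G a b = b"
      using a that A by (auto simp: mem_centralizer_iff)
    then show ?thesis by (metis conj_by_mult(1) conj_by_one inv_closed l_inv)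
  qed
  then show "inv a \<in> centralizer G A" using a A by (simp add: mem_centralizer_iff)
next
  fix a b assume "a \<in> centralizer G A" "b \<in> centralizer G A"
  then show "a \<otimes> b \<in> centralizer G A"
    using A by (auto simp: mem_centralizer_iff subset_iff conj_by_mult)
qed

section \<open>Left cosets and subgroups of finite index\<close>

lemma mem_l_coset_iff:
  assumes "subgroup H G" "x \<in> carrier G"
  shows "y \<in> x <# H \<longleftrightarrow> y \<in> carrier G \<and> inv x \<otimes> y \<in> H"
  using subgroup.lcos_module_imp[OF assms(1) is_group assms(2)]
    subgroup.lcos_module_rev[OF assms(1) is_group assms(2)]
    subgroup.elemlcos_carrier[OF assms(1) is_group assms(2)] by blast

lemma l_coset_eq_iff:
  assumes "subgroup H G" "x \<in> carrier G" "y \<in> carrier G"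
  shows "x <# H = y <# H \<longleftrightarrow> inv x \<otimes> y \<in> H"
  using assms by (metis l_repr_independence lcos_self mem_l_coset_iff)

lemma lcosets_eq_image: "lcosets H = (\<lambda>x. x <# H) ` carrier G"
  by (auto simp: LCOSETS_def)

text \<open>The value of \<open>\<phi>\<close> at a representative already determines the coset, so
  there are no more cosets than values.\<close>

lemma finite_indexI:
  assumes H: "subgroup H G" and fin: "finite (\<phi> ` carrier G)"
    and eq: "\<And>x y. x \<in> carrier G \<Longrightarrow> y \<in> carrier G \<Longrightarrow> \<phi> x = \<phi> y \<Longrightarrow> inv x \<otimes> y \<in> H"
  shows "finite_index G H"
proof -
  let ?r = "inv_into (carrier G) \<phi>"
  have "lcosets H \<subseteq> (\<lambda>z. ?r z <# H) ` \<phi> ` carrier G"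
  proof
    fix C assume "C \<in> lcosets H"
    then obtain x where x: "x \<in> carrier G" "C = x <# H" by (auto simp: lcosets_eq_image)
    then have "?r (\<phi> x) \<in> carrier G" "\<phi> (?r (\<phi> x)) = \<phi> x"
      by (auto intro: inv_into_into f_inv_into_f)
    then have "C = ?r (\<phi> x) <# H" using x eq H by (metis l_coset_eq_iff)
    with x(1) show "C \<in> (\<lambda>z. ?r z <# H) ` \<phi> ` carrier G" by blast
  qed
  with fin H show ?thesis unfolding finite_index_def by (meson finite_imageI finite_subset)
qed

lemma finite_indexD:
  assumes "finite_index G H"
  shows "subgroup H G" "finite ((\<lambda>x. x <# H) ` carrier G)" "H \<subseteq> carrier G"
  using assms subgroup.subset by (auto simp: finite_index_def lcosets_eq_image)

lemma finite_index_Int: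
  assumes H: "finite_index G H" and K: "finite_index G K"
  shows "finite_index G (H \<inter> K)"
proof (rule finite_indexI)
  show "subgroup (H \<inter> K) G" using assms finite_indexD(1) subgroups_Inter_pair by blast
  let ?\<phi> = "\<lambda>x. (x <# H, x <# K)"
  show "finite (?\<phi> ` carrier G)"
    by (rule finite_subset[OF _ finite_cartesian_product[OF finite_indexD(2)[OF H] finite_indexD(2)[OF K]]]) auto
  show "inv x \<otimes> y \<in> H \<inter> K" if "x \<in> carrier G" "y \<in> carrier G" "?\<phi> x = ?\<phi> y" for x y
    using that assms by (simp add: l_coset_eq_iff finite_index_def)
qed

text \<open>The conjugates of one element label the cosets of its centralizer; finitely many
  elements are treated by intersecting.\<close>

lemma finite_index_centralizer:
  assumes "finite A" "A \<subseteq> carrier G" "\<And>a. a \<in> A \<Longrightarrow> finite ((\<lambda>x. conj_by G x a) ` carrier G)"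
  shows "finite_index G (centralizer G A)"
  using assms
proof (induction A)
  case empty
  show ?case
    by (rule finite_indexI[of _ "\<lambda>x. ()"]) (auto simp: subgroup_centralizer, simp add: centralizer_def)
next
  case (insert a A)
  have a: "a \<in> carrier G" using insert.prems by simp
  have "finite_index G (centralizer G {a})"
  proof (rule finite_indexI)
    show "inv y \<otimes> z \<in> centralizer G {a}"
      if "y \<in> carrier G" "z \<in> carrier G" "conj_by G y a = conj_by G z a" for y z
      using that a by (simp add: conj_by_eq_iff)
  qed (use insert.prems in \<open>auto intro: subgroup_centralizer\<close>)
  moreover have "centralizer G (insert a A) = centralizer G {a} \<inter> centralizer G A"
    by (auto simp: centralizer_def)
  ultimately show ?case using insert by (simp add: finite_index_Int)
qed

text \<open>Unique existence records at once that the cosets of the representatives cover the group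
  and that they are disjoint.\<close>

lemma finite_index_transversal:
  assumes H: "finite_index G H"
  obtains R where "finite R" "R \<subseteq> carrier G"
    "\<And>x. x \<in> carrier G \<Longrightarrow> \<exists>!r. r \<in> R \<and> x \<in> r <# H"
proof -
  let ?f = "\<lambda>x. x <# H"
  let ?R = "inv_into (carrier G) ?f ` ?f ` carrier G"
  note sub = finite_indexD(1)[OF H]
  have 1: "finite ?R" using finite_indexD(2)[OF H] by (rule finite_imageI)
  have 2: "?R \<subseteq> carrier G" by (auto intro: inv_into_into)
  have "\<exists>!r. r \<in> ?R \<and> x \<in> r <# H" if x: "x \<in> carrier G" for x
  proof -
    have eq: "inv_into (carrier G) ?f (y <# H) <# H = y <# H" if "y \<in> carrier G" for y
      using f_inv_into_f[of "y <# H" ?f "carrier G"] that by blast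
    show ?thesis
    proof
      show "inv_into (carrier G) ?f (x <# H) \<in> ?R \<and> x \<in> inv_into (carrier G) ?f (x <# H) <# H"
        using eq[OF x] lcos_self[OF x sub] x by simp
    next
      fix r assume r: "r \<in> ?R \<and> x \<in> r <# H"
      then obtain y where y: "y \<in> carrier G" "r = inv_into (carrier G) ?f (y <# H)" by blast
      then have "x \<in> y <# H" using r eq by simp
      then have "y <# H = x <# H" using l_repr_independence y(1) sub by blast
      then show "r = inv_into (carrier G) ?f (x <# H)" using y by simp
    qed
  qed
  then show thesis using that 1 2 by blast
qed

text \<open>The core is the kernel of the action on the left cosets of \<open>H\<close> by
  multiplication, and a finite set has only finitely many self-maps.\<close>

lemma finite_index_core:
  assumes H: "finite_index G H"
  obtains K where "K \<lhd> G" "finite_index G K" "K \<subseteq> H"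
proof -
  note sub = finite_indexD(1)[OF H]
  note HG = finite_indexD(3)[OF H]
  define K where "K = {k \<in> carrier G. \<forall>x\<in>carrier G. conj_by G x k \<in> H}"
  have KH: "K \<subseteq> H"
  proof
    fix k assume "k \<in> K"
    then have "k \<in> carrier G" "conj_by G \<one> k \<in> H" by (auto simp: K_def)
    then show "k \<in> H" by (simp add: conj_by_one)
  qed
  have subK: "subgroup K G"
  proof (rule subgroupI)
    have "\<one> \<in> K" using subgroup.one_closed[OF sub] by (simp add: K_def conj_by_def)
    then show "K \<noteq> {}" by blast
  qed (auto simp: K_def conj_by_inv conj_by_mult subgroup.m_closed[OF sub] subgroup.m_inv_closed[OF sub])
  have "K \<lhd> G"
  proof (rule normal_invI[OF subK])
    fix x k assume "x \<in> carrier G" "k \<in> K"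
    then have "conj_by G x k \<in> K"
      unfolding K_def by (auto simp flip: conj_by_mult(1))
    then show "x \<otimes> k \<otimes> inv x \<in> K" by (simp add: conj_by_def)
  qed
  moreover have "finite_index G K"
  proof (rule finite_indexI[OF subK])
    let ?\<phi> = "\<lambda>x. restrict (\<lambda>C. x <# C) (lcosets H)"
    have "x <# C \<in> lcosets H" if "x \<in> carrier G" "C \<in> lcosets H" for x C
      using that by (auto simp: lcosets_eq_image lcos_m_assoc[OF HG])
    then have "?\<phi> ` carrier G \<subseteq> lcosets H \<rightarrow>\<^sub>E lcosets H" by auto
    then show "finite (?\<phi> ` carrier G)"
      by (rule finite_subset) (use H in \<open>auto intro: finite_PiE simp: finite_index_def\<close>)
    show "inv x \<otimes> y \<in> K" if x: "x \<in> carrier G" and y: "y \<in> carrier G" and eq: "?\<phi> x = ?\<phi> y" for x y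
    proof -
      have "conj_by G z (inv x \<otimes> y) \<in> H" if z: "z \<in> carrier G" for z
      proof -
        \<comment> \<open>Evaluating the action at the coset of \<open>inv z\<close> yields the
          condition on the conjugate by \<open>z\<close>.\<close>
        have "?\<phi> x (inv z <# H) = ?\<phi> y (inv z <# H)" using eq by simp
        then have "x <# (inv z <# H) = y <# (inv z <# H)" using z by (simp add: lcosets_eq_image)
        then have "(x \<otimes> inv z) <# H = (y \<otimes> inv z) <# H" using x y z by (simp add: lcos_m_assoc[OF HG])
        then have "inv (x \<otimes> inv z) \<otimes> (y \<otimes> inv z) \<in> H" using x y z sub by (simp add: l_coset_eq_iff)
        then show ?thesis using x y z by (simp add: group_simps)
      qed
      then show ?thesis using x y by (simp add: K_def)
    qed
  qed
  ultimately show thesis using KH that by blast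
qed

text \<open>Inversion exchanges left and right cosets.\<close>

lemma finite_rcosets_iff_lcosets:
  assumes H: "subgroup H G"
  shows "finite (rcosets H) \<longleftrightarrow> finite (lcosets H)"
proof
  assume fin: "finite (rcosets H)"
  have "finite_index G H"
  proof (rule finite_indexI[OF H])
    have "(\<lambda>x. H #> inv x) ` carrier G \<subseteq> rcosets H" by (auto simp: RCOSETS_def)
    then show "finite ((\<lambda>x. H #> inv x) ` carrier G)" using fin finite_subset by blast
    fix x y assume x: "x \<in> carrier G" and y: "y \<in> carrier G" and "H #> inv x = H #> inv y"
    then have "inv x \<in> H #> inv y" using rcos_self[OF _ H] by (metis inv_closed)
    then obtain h where "h \<in> H" "inv x = h \<otimes> inv y" by (auto simp: r_coset_def)
    moreover from this have "inv x \<otimes> y = h" using y subgroup.mem_carrier[OF H] by (simp add: m_assoc)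
    ultimately show "inv x \<otimes> y \<in> H" by simp
  qed
  then show "finite (lcosets H)" by (simp add: finite_index_def)
next
  assume fin: "finite (lcosets H)"
  have "rcosets H \<subseteq> (\<lambda>C. (\<lambda>x. inv x) ` C) ` (lcosets H)"
  proof
    fix C assume "C \<in> rcosets H"
    then obtain x where x: "x \<in> carrier G" "C = H #> x" by (auto simp: RCOSETS_def)
    have "C = (\<lambda>x. inv x) ` (inv x <# H)"
    proof (intro equalityI subsetI)
      fix z assume "z \<in> C"
      then obtain h where h: "h \<in> H" "z = h \<otimes> x" using x by (auto simp: r_coset_def)
      then have "z = inv (inv x \<otimes> inv h)" using x subgroup.mem_carrier[OF H] by (simp add: inv_mult_group)
      then show "z \<in> (\<lambda>x. inv x) ` (inv x <# H)"
        using subgroup.m_inv_closed[OF H h(1)] by (auto simp: l_coset_def)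
    next
      fix z assume "z \<in> (\<lambda>x. inv x) ` (inv x <# H)"
      then obtain h where h: "h \<in> H" "z = inv (inv x \<otimes> h)" by (auto simp: l_coset_def)
      then have "z = inv h \<otimes> x" using x subgroup.mem_carrier[OF H] by (simp add: inv_mult_group)
      then show "z \<in> C" using x subgroup.m_inv_closed[OF H h(1)] by (auto simp: r_coset_def)
    qed
    with x show "C \<in> (\<lambda>C. (\<lambda>x. inv x) ` C) ` (lcosets H)" by (auto simp: lcosets_eq_image)
  qed
  then show "finite (rcosets H)" using fin by (rule finite_surj[rotated])
qed

lemma inv_index_pos_iff:
  assumes "subgroup H G"
  shows "0 < inv_index G H \<longleftrightarrow> finite_index G H"
proof -
  have "rcosets H \<noteq> {}" by (auto simp: RCOSETS_def)
  then show ?thesis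
    using finite_rcosets_iff_lcosets[OF assms] assms
    by (auto simp: inv_index_def finite_index_def card_gt_0_iff)
qed

lemma inv_index_nonneg: "0 \<le> inv_index G H"
  by (simp add: inv_index_def)

lemma inv_index_rat: "inv_index G H \<in> \<rat>"
  by (simp add: inv_index_def)

end

section \<open>Groups with conjugacy classes of bounded size\<close>

context group
begin

text \<open>
  If the conjugates of \<open>a\<close> by \<open>F\<close> are as many as possible and all arise from the finite set \<open>T\<close>, then
  for \<open>k\<close> commuting with \<open>T\<close> the conjugates of \<open>k \<otimes> a\<close> are the products of \<open>k\<close> with conjugates of \<open>a\<close>,
  so that commutators with \<open>k\<close> are quotients of conjugates of \<open>a\<close>.
\<close>

lemma cmt_in_quotients_of_conjugates:
  assumes F: "finite_index G F"
    and fin: "\<And>g. g \<in> F \<Longrightarrow> finite ((\<lambda>x. conj_by G x g) ` carrier G)"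
    and bound: "\<And>g. g \<in> F \<Longrightarrow> card ((\<lambda>x. conj_by G x g) ` F) \<le> M"
  obtains a K where "a \<in> F" "K \<subseteq> F" "finite_index G K"
    "\<And>k x. k \<in> K \<Longrightarrow> x \<in> F \<Longrightarrow> \<exists>y\<in>F. cmt G k x = conj_by G y a \<otimes> inv (conj_by G x a)"
proof -
  note subF = finite_indexD(1)[OF F]
  note FG = finite_indexD(3)[OF F]
  let ?c = "\<lambda>g. (\<lambda>x. conj_by G x g) ` F"
  have finc: "finite (?c g)" if "g \<in> F" for g
    using fin[OF that] FG by (meson finite_subset image_mono)
  obtain a where a: "a \<in> F" and max: "\<And>g. g \<in> F \<Longrightarrow> card (?c g) \<le> card (?c a)"
  proof -
    have "\<exists>a. a \<in> F \<and> (\<forall>g. g \<in> F \<longrightarrow> card (?c g) \<le> card (?c a))"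
      by (rule ex_has_greatest_nat[of _ \<one> _ "Suc M"])
        (use bound subgroup.one_closed[OF subF] in \<open>auto simp: less_Suc_eq_le\<close>)
    then show thesis using that by blast
  qed
  have aG: "a \<in> carrier G" using a FG by blast
  obtain T where T: "T \<subseteq> F" "finite T" "?c a = (\<lambda>x. conj_by G x a) ` T"
    using finite_subset_image[OF finc[OF a] subset_refl] by blast
  define K where "K = F \<inter> centralizer G T"
  have "finite_index G K"
    unfolding K_def using T FG fin by (intro finite_index_Int F finite_index_centralizer) auto
  moreover have "\<exists>y\<in>F. cmt G k x = conj_by G y a \<otimes> inv (conj_by G x a)"
    if k: "k \<in> K" and x: "x \<in> F" for k x
  proof -
    have kF: "k \<in> F" and kG: "k \<in> carrier G" and xG: "x \<in> carrier G" using k x FG by (auto simp: K_def)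
    have kaF: "k \<otimes> a \<in> F" using subgroup.m_closed[OF subF kF a] .
    have "conj_by G t (k \<otimes> a) = k \<otimes> conj_by G t a" if "t \<in> T" for t
    proof -
      have tG: "t \<in> carrier G" using that T FG by blast
      have "t \<otimes> k = k \<otimes> t" using k that centralizerD(2) by (auto simp: K_def)
      then have "conj_by G k t = t" using commutes_iff_conj_by tG kG by blast
      then have "conj_by G t k = k"
        using commutes_iff_conj_by tG kG by metis
      then show ?thesis using tG kG aG by (simp add: conj_by_mult)
    qed
    then have "(\<lambda>y. k \<otimes> y) ` ?c a = (\<lambda>t. conj_by G t (k \<otimes> a)) ` T"
      unfolding T(3) by (simp add: image_image)
    then have sub: "(\<lambda>y. k \<otimes> y) ` ?c a \<subseteq> ?c (k \<otimes> a)" using T(1) by auto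
    have "inj_on (\<lambda>y. k \<otimes> y) (?c a)"
      using kG aG FG by (intro inj_onI) (auto simp: subset_iff)
    then have "card ((\<lambda>y. k \<otimes> y) ` ?c a) = card (?c a)" by (rule card_image)
    \<comment> \<open>The translate has the maximal cardinality, so its inclusion in the class of
      \<open>k \<otimes> a\<close> is an equality.\<close>
    then have "(\<lambda>y. k \<otimes> y) ` ?c a = ?c (k \<otimes> a)"
      using max[OF kaF] by (intro card_seteq finc[OF kaF] sub) simp
    then have "conj_by G x (k \<otimes> a) \<in> (\<lambda>y. k \<otimes> y) ` ?c a" using x by blast
    then obtain y where y: "y \<in> F" "conj_by G x (k \<otimes> a) = k \<otimes> conj_by G y a" by blast
    have "y \<in> carrier G" using y(1) FG by blast
    have "cmt G k x = inv k \<otimes> conj_by G x (k \<otimes> a) \<otimes> inv (conj_by G x a)"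
      using kG xG aG by (simp add: group_simps)
    also have "\<dots> = conj_by G y a \<otimes> inv (conj_by G x a)"
      unfolding y(2) using kG xG aG \<open>y \<in> carrier G\<close> by (simp add: m_assoc)
    finally show ?thesis using y(1) by blast
  qed
  ultimately show thesis using that[OF a] K_def by blast
qed

text \<open>The first application of \<open>cmt_in_quotients_of_conjugates\<close> leaves only
  finitely many commutators in \<open>K\<close>, but these need not form a subgroup. Centralizing
  them and applying it again places all commutators in the image of a homomorphism, which is a
  finite subgroup.\<close>

lemma finite_index_finite_derived_if_bounded_classes:
  assumes F: "finite_index G F"
    and fin: "\<And>g. g \<in> F \<Longrightarrow> finite ((\<lambda>x. conj_by G x g) ` carrier G)"
    and bound: "\<And>g. g \<in> F \<Longrightarrow> card ((\<lambda>x. conj_by G x g) ` carrier G) \<le> M"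
  obtains K where "finite_index G K" "finite (derived G K)"
proof -
  have boundF: "card ((\<lambda>x. conj_by G x g) ` L) \<le> M" if "g \<in> F" "L \<subseteq> carrier G" for g L
    using card_mono[OF fin[OF that(1)] image_mono[OF that(2)]] bound[OF that(1)] by (rule order_trans)
  note FG = finite_indexD(3)[OF F]
  obtain a K where a: "a \<in> F" and K: "K \<subseteq> F" "finite_index G K"
    and D: "\<And>k x. k \<in> K \<Longrightarrow> x \<in> F \<Longrightarrow> \<exists>y\<in>F. cmt G k x = conj_by G y a \<otimes> inv (conj_by G x a)"
    using cmt_in_quotients_of_conjugates[OF F fin boundF[OF _ FG]] by blast
  note KG = finite_indexD(3)[OF K(2)]
  let ?D = "{cmt G k x |k x. k \<in> K \<and> x \<in> K}"
  have "?D \<subseteq> (\<lambda>(u, v). u \<otimes> inv v) ` (((\<lambda>x. conj_by G x a) ` carrier G) \<times> ((\<lambda>x. conj_by G x a) ` carrier G))"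
  proof
    fix d assume "d \<in> ?D"
    then obtain k x where "k \<in> K" "x \<in> K" "d = cmt G k x" by blast
    moreover obtain y where "y \<in> F" "cmt G k x = conj_by G y a \<otimes> inv (conj_by G x a)"
      using D[of k x] calculation K(1) by blast
    ultimately show "d \<in> (\<lambda>(u, v). u \<otimes> inv v) ` (((\<lambda>x. conj_by G x a) ` carrier G) \<times> ((\<lambda>x. conj_by G x a) ` carrier G))"
      using FG K(1) by (intro image_eqI[of _ _ "(conj_by G y a, conj_by G x a)"]) auto
  qed
  then have finD: "finite ?D"
    by (rule finite_subset) (use fin[OF a] in simp)
  have DK: "?D \<subseteq> K"
    using finite_indexD(1)[OF K(2)]
    by (auto simp: cmt_def conj_by_def intro!: subgroup.m_closed subgroup.m_inv_closed)
  \<comment> \<open>Commutators of elements of \<open>L\<close> belong to \<open>?D\<close>, which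
    \<open>L\<close> centralizes; hence they are central in \<open>L\<close>.\<close>
  define L where "L = K \<inter> centralizer G ?D"
  have L: "finite_index G L"
    unfolding L_def
    by (intro finite_index_Int K(2) finite_index_centralizer finD fin) (use DK K KG in blast)+
  note subL = finite_indexD(1)[OF L]
  have LG: "L \<subseteq> carrier G" using finite_indexD(3)[OF L] .
  have LF: "L \<subseteq> F" using K(1) by (auto simp: L_def)
  have cmtL: "cmt G k x \<in> L" "cmt G k x \<in> ?D" if "k \<in> L" "x \<in> L" for k x
  proof -
    show "cmt G k x \<in> L" using that subL
      by (auto simp: cmt_def conj_by_def intro!: subgroup.m_closed subgroup.m_inv_closed)
    show "cmt G k x \<in> ?D" using that by (auto simp: L_def)
  qed
  have central: "d \<otimes> l = l \<otimes> d" if "d \<in> ?D" "l \<in> L" for d l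
    using that centralizerD(2) unfolding L_def by blast
  obtain b H where b: "b \<in> L" and H: "H \<subseteq> L" "finite_index G H"
    and E: "\<And>k x. k \<in> H \<Longrightarrow> x \<in> L \<Longrightarrow> \<exists>y\<in>L. cmt G k x = conj_by G y b \<otimes> inv (conj_by G x b)"
    using cmt_in_quotients_of_conjugates[OF L fin boundF[OF _ LG]] LF by blast
  have bG: "b \<in> carrier G" using b LG by blast
  define N where "N = (\<lambda>x. cmt G b x) ` L"
  \<comment> \<open>Centrality makes \<open>cmt G b\<close> a homomorphism on \<open>L\<close>, so
    that \<open>N\<close> is a subgroup.\<close>
  have cmt_mult: "cmt G b (x \<otimes> y) = cmt G b x \<otimes> cmt G b y" if "x \<in> L" "y \<in> L" for x y
  proof -
    have xy: "x \<in> carrier G" "y \<in> carrier G" using that LG by auto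
    have "cmt G b (x \<otimes> y) = inv b \<otimes> x \<otimes> b \<otimes> (cmt G b y \<otimes> inv x)"
      using xy bG by (simp add: group_simps)
    also have "cmt G b y \<otimes> inv x = inv x \<otimes> cmt G b y"
      using central[OF cmtL(2)[OF b that(2)]] subgroup.m_inv_closed[OF subL that(1)] by blast
    also have "inv b \<otimes> x \<otimes> b \<otimes> (inv x \<otimes> cmt G b y) = cmt G b x \<otimes> cmt G b y"
      using xy bG by (simp add: group_simps)
    finally show ?thesis .
  qed
  have "finite N" unfolding N_def by (rule finite_subset[OF _ finD]) (use cmtL(2) b in auto)
  moreover have subN: "subgroup N G"
  proof (rule subgroupI)
    show "N \<subseteq> carrier G" using LG bG by (auto simp: N_def)
    show "N \<noteq> {}" using b by (auto simp: N_def)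
  next
    fix n assume "n \<in> N"
    then obtain x where x: "x \<in> L" "n = cmt G b x" by (auto simp: N_def)
    have "cmt G b (inv x) \<otimes> cmt G b x = cmt G b (inv x \<otimes> x)"
      using cmt_mult[OF subgroup.m_inv_closed[OF subL x(1)] x(1)] by simp
    also have "\<dots> = \<one>" using x LG bG by (auto simp: group_simps)
    finally have "inv n = cmt G b (inv x)"
      unfolding x(2) using x(1) LG bG by (intro inv_equality) auto
    then show "inv n \<in> N" using subgroup.m_inv_closed[OF subL x(1)] by (auto simp: N_def)
  next
    fix n m assume "n \<in> N" "m \<in> N"
    then show "n \<otimes> m \<in> N"
      using subgroup.m_closed[OF subL] by (auto simp: N_def simp flip: cmt_mult)
  qed
  moreover have "derived G H \<subseteq> N"
    unfolding derived_def
  proof (rule generate_subgroup_incl[OF _ subN], rule subsetI)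
    fix d assume "d \<in> derived_set G H"
    then obtain k x where k: "k \<in> H" and x: "x \<in> H" and d: "d = k \<otimes> x \<otimes> inv k \<otimes> inv x" by blast
    have kx: "k \<in> carrier G" "x \<in> carrier G" using k x H LG by auto
    \<comment> \<open>The commutators in \<open>derived_set\<close> follow the other convention,
      which accounts for the inverse of \<open>k\<close>.\<close>
    have "d = cmt G (inv k) x" using d kx by (simp add: group_simps)
    moreover obtain y where y: "y \<in> L" "cmt G (inv k) x = conj_by G y b \<otimes> inv (conj_by G x b)"
      using E[OF subgroup.m_inv_closed[OF finite_indexD(1)[OF H(2)] k], of x] x H(1) by blast
    moreover have "\<dots> = cmt G b y \<otimes> inv (cmt G b x)"
    proof -
      have yG: "y \<in> carrier G" using y(1) LG by blast
      \<comment> \<open>Central commutators can be moved to the left of \<open>b\<close>, and then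
        \<open>b\<close> cancels in the quotient of the two conjugates.\<close>
      have "conj_by G y b = cmt G b y \<otimes> b" "conj_by G x b = cmt G b x \<otimes> b"
        using central[OF cmtL(2)[OF b] b] y(1) x H(1) yG kx bG by (auto simp: conj_by_eq_cmt)
      then show ?thesis using yG kx bG by (simp add: m_assoc inv_mult_group)
    qed
    moreover have "cmt G b y \<otimes> inv (cmt G b x) \<in> N"
      using y(1) x H(1) by (intro subgroup.m_closed[OF subN] subgroup.m_inv_closed[OF subN]) (auto simp: N_def)
    ultimately show "d \<in> N" by simp
  qed
  ultimately show thesis using that[OF H(2)] finite_subset by blast
qed

text \<open>An abelian quotient by \<open>N\<close> forces the derived subgroup into
  \<open>N\<close>; conversely the derived subgroup itself serves as \<open>N\<close>, after
  \<open>H\<close> has been replaced by its normal core.\<close>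

lemma finite_by_abelian_by_finite_iff:
  "finite_by_abelian_by_finite G \<longleftrightarrow> (\<exists>H. finite_index G H \<and> finite (derived G H))"
proof
  assume "finite_by_abelian_by_finite G"
  then obtain H N where H: "H \<lhd> G" "finite (rcosets H)"
    and N: "N \<lhd> (G\<lparr>carrier := H\<rparr>)" "finite N" "comm_group ((G\<lparr>carrier := H\<rparr>) Mod N)"
    unfolding finite_by_abelian_by_finite_def by blast
  have sub: "subgroup H G" using H(1) by (rule normal_imp_subgroup)
  then have "finite_index G H" using H(2) by (simp add: finite_index_def finite_rcosets_iff_lcosets)
  moreover have "derived G H \<subseteq> N" using derived_of_subgroup_minimal[OF N(1) sub N(3)] .
  ultimately show "\<exists>H. finite_index G H \<and> finite (derived G H)" using N(2) finite_subset by blast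
next
  assume "\<exists>H. finite_index G H \<and> finite (derived G H)"
  then obtain L where L: "finite_index G L" "finite (derived G L)" by blast
  obtain H where H: "H \<lhd> G" "finite_index G H" "H \<subseteq> L" using finite_index_core[OF L(1)] .
  note sub = finite_indexD(1)[OF H(2)]
  have "derived G H \<subseteq> derived G L"
    unfolding derived_def using H(3) by (intro mono_generate) blast
  then have "finite (derived G H)" using L(2) finite_subset by blast
  moreover have "finite (rcosets H)"
    using H(2) by (simp add: finite_index_def finite_rcosets_iff_lcosets)
  ultimately show "finite_by_abelian_by_finite G"
    unfolding finite_by_abelian_by_finite_def
    using H(1) derived_subgroup_is_normal[OF sub] derived_quot_of_subgroup_is_comm_group[OF sub] by blast
qed

end

section \<open>Coset correct means\<close>

lemma coset_correct_meanD:
  assumes "coset_correct_mean G \<mu>"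
  shows "fin_add_mean G \<mu>"
    "subgroup H G \<Longrightarrow> g \<in> carrier G \<Longrightarrow> \<mu> (g <#\<^bsub>G\<^esub> H) = inv_index G H"
  using assms unfolding coset_correct_mean_def by auto

context group
begin

lemma coset_correct_mean_subgroup:
  assumes "coset_correct_mean G \<mu>" "subgroup H G"
  shows "\<mu> H = inv_index G H"
  using coset_correct_meanD(2)[OF assms one_closed] by (simp add: lcos_mult_one subgroup.subset[OF assms(2)])

section \<open>Elements with finitely many conjugates\<close>

definition conj_class :: "'a \<Rightarrow> 'a set" where
  "conj_class g = (\<lambda>x. conj_by G x g) ` carrier G"

definition fc_center :: "'a set" where
  "fc_center = {g \<in> carrier G. finite (conj_class g)}"

lemma conj_class_mult_subset:
  assumes "g \<in> carrier G" "h \<in> carrier G"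
  shows "conj_class (g \<otimes> h) \<subseteq> (\<lambda>(u, v). u \<otimes> v) ` (conj_class g \<times> conj_class h)"
  using assms unfolding conj_class_def by (auto simp: conj_by_mult)

lemma subgroup_fc_center: "subgroup fc_center G"
proof (rule subgroupI)
  show "fc_center \<subseteq> carrier G" by (auto simp: fc_center_def)
  have "conj_class \<one> \<subseteq> {\<one>}" by (auto simp: conj_class_def conj_by_def)
  then have "\<one> \<in> fc_center" by (auto simp: fc_center_def intro: finite_subset)
  then show "fc_center \<noteq> {}" by blast
next
  fix a assume a: "a \<in> fc_center"
  then have "conj_class (inv a) \<subseteq> (\<lambda>x. inv x) ` conj_class a"
    by (auto simp: conj_class_def fc_center_def conj_by_inv)
  with a show "inv a \<in> fc_center" by (auto simp: fc_center_def intro: finite_subset)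
next
  fix a b assume ab: "a \<in> fc_center" "b \<in> fc_center"
  then have "finite (conj_class (a \<otimes> b))"
    by (intro finite_subset[OF conj_class_mult_subset]) (auto simp: fc_center_def)
  with ab show "a \<otimes> b \<in> fc_center" by (simp add: fc_center_def)
qed

lemma finite_index_centralizer_fc:
  "finite A \<Longrightarrow> A \<subseteq> fc_center \<Longrightarrow> finite_index G (centralizer G A)"
  by (rule finite_index_centralizer) (auto simp: fc_center_def conj_class_def)

section \<open>Measures of centralizers and sizes of conjugacy classes\<close>

lemma disjoint_family_l_cosets:
  assumes H: "subgroup H G" and E: "E \<subseteq> carrier G" and inj: "inj_on (\<lambda>x. x <# H) E"
  shows "disjoint_family_on (\<lambda>x. x <# H) E"
  unfolding disjoint_family_on_def
proof (intro ballI impI)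
  fix x y assume xy: "x \<in> E" "y \<in> E" "x \<noteq> y"
  then have "x <# H \<noteq> y <# H" using inj by (auto dest: inj_onD)
  then show "(x <# H) \<inter> (y <# H) = {}"
    using xy E H l_repr_independence by blast
qed

text \<open>Distinct conjugates give disjoint cosets of the centralizer, each of measure at least
  \<open>e\<close>, and the total measure is 1.\<close>

lemma card_conj_class_le:
  assumes \<mu>: "coset_correct_mean G \<mu>" and g: "g \<in> carrier G"
    and e: "0 < e" "e \<le> \<mu> (centralizer G {g})"
  shows "finite (conj_class g) \<and> card (conj_class g) \<le> nat \<lfloor>1 / e\<rfloor>"
\<comment> \<open>The class is not yet known to be finite, so the bound is proved for its finite
  subsets.\<close>
proof (rule finite_if_finite_subsets_card_bdd)
  fix D assume D: "D \<subseteq> conj_class g" "finite D"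
  then obtain E where E: "E \<subseteq> carrier G" "inj_on (\<lambda>x. conj_by G x g) E" "D = (\<lambda>x. conj_by G x g) ` E"
    unfolding conj_class_def using subset_image_inj[of D "\<lambda>x. conj_by G x g"] by blast
  let ?C = "centralizer G {g}"
  note m = coset_correct_meanD(1)[OF \<mu>]
  have sub: "subgroup ?C G" using g by (intro subgroup_centralizer) simp
  have finE: "finite E" using E D finite_imageD by blast
  have disj: "disjoint_family_on (\<lambda>x. x <# ?C) E"
  proof (rule disjoint_family_l_cosets[OF sub E(1)], rule inj_onI)
    fix x y assume "x \<in> E" "y \<in> E" "x <# ?C = y <# ?C"
    then show "x = y" using E(1,2) g sub
      by (auto simp: l_coset_eq_iff subset_iff inj_on_def simp flip: conj_by_eq_iff)
  qed
  have subC: "x <# ?C \<subseteq> carrier G" if "x \<in> E" for x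
    using that E(1) l_coset_subset_G subgroup.subset[OF sub] by blast
  have "real (card D) * e \<le> real (card E) * \<mu> ?C"
    unfolding E(3) using e by (simp add: card_image[OF E(2)] mult_left_mono)
  also have "\<dots> = (\<Sum>x\<in>E. \<mu> (x <# ?C))"
    using E(1) sub
    by (simp add: coset_correct_meanD(2)[OF \<mu>] coset_correct_mean_subgroup[OF \<mu>] subset_iff)
  also have "\<dots> = \<mu> (\<Union>x\<in>E. x <# ?C)"
    by (rule fin_add_mean_UN[OF m finE subC disj, symmetric])
  also have "\<dots> \<le> 1" using subC by (intro fin_add_meanD(2)[OF m]) blast
  finally have "real (card D) \<le> 1 / e" using e by (simp add: field_simps)
  then show "card D \<le> nat \<lfloor>1 / e\<rfloor>" by linarith
qed

lemma centralizer_singleton_pos_iff: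
  assumes \<mu>: "coset_correct_mean G \<mu>" and g: "g \<in> carrier G"
  shows "0 < \<mu> (centralizer G {g}) \<longleftrightarrow> g \<in> fc_center"
proof
  assume "0 < \<mu> (centralizer G {g})"
  then show "g \<in> fc_center" using card_conj_class_le[OF \<mu> g _ order_refl] g by (simp add: fc_center_def)
next
  assume "g \<in> fc_center"
  then have "finite_index G (centralizer G {g})" by (simp add: finite_index_centralizer_fc)
  then show "0 < \<mu> (centralizer G {g})"
    by (metis coset_correct_mean_subgroup[OF \<mu>] finite_indexD(1) inv_index_pos_iff)
qed

lemma centralizer_inv:
  assumes "x \<in> carrier G"
  shows "centralizer G {inv x} = centralizer G {x}"
proof -
  have "centralizer G {y} \<subseteq> centralizer G {inv y}" if "y \<in> carrier G" for y
    using that by (auto simp: mem_centralizer_singleton_iff conj_by_inv)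
  from this[of x] this[of "inv x"] show ?thesis using assms by auto
qed

text \<open>
  If \<open>g\<close> has fewer than \<open>n\<close> conjugates, then two of any \<open>n\<close> elements conjugate it in the same way and
  so have their quotient in the centralizer of \<open>g\<close>. Hence a set whose quotients all have small
  centralizers is of bounded size; a largest such set \<open>E\<close> writes \<open>G\<close> as \<open>E\<close> times elements with
  large centralizers.
\<close>

lemma finite_index_finite_derived_if_centralizers_large:
  assumes \<mu>: "coset_correct_mean G \<mu>" and e: "0 < e"
    and pos: "\<mu> {g \<in> carrier G. e \<le> \<mu> (centralizer G {g})} \<noteq> 0"
  obtains K where "finite_index G K" "finite (derived G K)"
proof -
  note m = coset_correct_meanD(1)[OF \<mu>]
  define Z where "Z = {g \<in> carrier G. e \<le> \<mu> (centralizer G {g})}"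
  have ZG: "Z \<subseteq> carrier G" by (auto simp: Z_def)
  have Zpos: "0 < \<mu> Z" using pos fin_add_meanD(1)[OF m ZG] by (simp add: Z_def)
  \<comment> \<open>Every element of \<open>Z\<close> has fewer than \<open>n\<close>
    conjugates.\<close>
  define n where "n = Suc (nat \<lfloor>1 / e\<rfloor>)"
  \<comment> \<open>Chosen so that \<open>n * n\<close> centralizers of measure at most
    \<open>d\<close> cannot cover \<open>Z\<close>; the added 1 makes the comparison strict.\<close>
  define d where "d = \<mu> Z / (real n * real n + 1)"
  have "0 < d" using Zpos by (simp add: d_def add_nonneg_pos)
  \<comment> \<open>With \<open>d\<close> at most 1, an element of the maximal set can represent
    itself below, as the centralizer of \<open>\<one>\<close> has measure 1.\<close>
  have "d \<le> \<mu> Z / 1" unfolding d_def using Zpos by (intro divide_left_mono) (auto simp: add_nonneg_pos)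
  then have "d \<le> 1" using fin_add_meanD(2)[OF m ZG] by simp
  define sep where "sep E \<longleftrightarrow> finite E \<and> E \<subseteq> carrier G \<and>
    (\<forall>x\<in>E. \<forall>y\<in>E. x \<noteq> y \<longrightarrow> \<mu> (centralizer G {inv x \<otimes> y}) < d)" for E
  have sep_card: "card E < n" if "sep E" for E
  proof (rule ccontr)
    assume "\<not> card E < n"
    then obtain E' where E': "E' \<subseteq> E" "card E' = n" "finite E'"
      using obtain_subset_with_card_n[of n E] by auto
    have E'G: "E' \<subseteq> carrier G" using E'(1) that by (auto simp: sep_def)
    define P where "P = {p \<in> E' \<times> E'. fst p \<noteq> snd p}"
    have PE: "P \<subseteq> E' \<times> E'" by (auto simp: P_def)
    have finP: "finite P" using PE E'(3) finite_subset by blast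
    have "card P \<le> n * n"
      using card_mono[OF _ PE] E'(2,3) by (simp add: card_cartesian_product)
    have cent: "centralizer G {inv (fst p) \<otimes> snd p} \<subseteq> carrier G" for p
      by (auto simp: centralizer_def)
    have "Z \<subseteq> (\<Union>p\<in>P. centralizer G {inv (fst p) \<otimes> snd p})"
    proof
      fix g assume "g \<in> Z"
      then have g: "g \<in> carrier G" "e \<le> \<mu> (centralizer G {g})" by (auto simp: Z_def)
      have cls: "finite (conj_class g)" "card (conj_class g) < n"
        using card_conj_class_le[OF \<mu> g(1) e g(2)] by (auto simp: n_def)
      have "(\<lambda>x. conj_by G x g) ` E' \<subseteq> conj_class g" using E'G by (auto simp: conj_class_def)
      from card_mono[OF cls(1) this] have "card ((\<lambda>x. conj_by G x g) ` E') \<noteq> card E'"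
        using cls(2) E'(2) by linarith
      then have "\<not> inj_on (\<lambda>x. conj_by G x g) E'" using card_image by blast
      then obtain x y where xy: "x \<in> E'" "y \<in> E'" "x \<noteq> y" "conj_by G x g = conj_by G y g"
        by (auto simp: inj_on_def)
      have xyG: "x \<in> carrier G" "y \<in> carrier G" using xy E'G by auto
      have "inv x \<otimes> y \<in> centralizer G {g}" using conj_by_eq_iff xy(4) xyG g(1) by blast
      then have "g \<in> centralizer G {inv x \<otimes> y}" using g(1) by (auto simp: centralizer_def)
      moreover have "(x, y) \<in> P" using xy by (simp add: P_def)
      ultimately show "g \<in> (\<Union>p\<in>P. centralizer G {inv (fst p) \<otimes> snd p})" by force
    qed
    then have "\<mu> Z \<le> \<mu> (\<Union>p\<in>P. centralizer G {inv (fst p) \<otimes> snd p})"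
      using cent by (intro fin_add_mean_mono[OF m]) blast+
    also have "\<dots> \<le> (\<Sum>p\<in>P. \<mu> (centralizer G {inv (fst p) \<otimes> snd p}))"
      by (rule fin_add_mean_UN_le[OF m finP cent])
    also have "\<dots> \<le> (\<Sum>p\<in>P. d)"
    proof (rule sum_mono)
      fix p assume "p \<in> P"
      then have "fst p \<in> E" "snd p \<in> E" "fst p \<noteq> snd p" using E'(1) by (auto simp: P_def)
      then show "\<mu> (centralizer G {inv (fst p) \<otimes> snd p}) \<le> d"
        using that unfolding sep_def by (metis less_imp_le)
    qed
    also have "\<dots> = real (card P) * d" by simp
    also have "\<dots> \<le> real (n * n) * d"
      using \<open>card P \<le> n * n\<close> \<open>0 < d\<close> by (intro mult_right_mono) (auto simp del: of_nat_mult)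
    also have "\<dots> < (real n * real n + 1) * d" using \<open>0 < d\<close> by (simp add: algebra_simps)
    also have "\<dots> = \<mu> Z" by (simp add: d_def add_nonneg_eq_0_iff)
    finally show False by simp
  qed
  have "\<exists>E. sep E \<and> (\<forall>E'. sep E' \<longrightarrow> card E' \<le> card E)"
    by (rule ex_has_greatest_nat[of sep "{}" card n]) (use sep_card in \<open>auto simp: sep_def\<close>)
  then obtain E where E: "sep E" and max: "\<And>E'. sep E' \<Longrightarrow> card E' \<le> card E" by blast
  have finE: "finite E" and EG: "E \<subseteq> carrier G" using E by (auto simp: sep_def)
  have ex: "\<exists>x\<in>E. d \<le> \<mu> (centralizer G {inv x \<otimes> h})" if h: "h \<in> carrier G" for h
  proof (cases "h \<in> E")
    case True
    have "centralizer G {\<one>} = carrier G" by (auto simp: centralizer_def)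
    then have "\<mu> (centralizer G {inv h \<otimes> h}) = 1" using h fin_add_meanD(3)[OF m] by simp
    with True \<open>d \<le> 1\<close> show ?thesis by metis
  next
    case False
    show ?thesis
    proof (rule ccontr)
      assume "\<not> ?thesis"
      then have small: "\<mu> (centralizer G {inv x \<otimes> h}) < d" if "x \<in> E" for x using that by auto
      \<comment> \<open>Separation concerns both orders of a pair; the two quotients are inverse to
        each other and so have the same centralizer.\<close>
      have "centralizer G {inv h \<otimes> x} = centralizer G {inv x \<otimes> h}" if "x \<in> E" for x
        using centralizer_inv[of "inv x \<otimes> h"] that h EG by (auto simp: inv_mult_group subset_iff)
      then have "sep (insert h E)"
        using E small h by (auto simp: sep_def)
      then show False using max[of "insert h E"] False finE by simp
    qed
  qed
  define \<phi> where "\<phi> h = (SOME x. x \<in> E \<and> d \<le> \<mu> (centralizer G {inv x \<otimes> h}))" for h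
  have \<phi>: "\<phi> h \<in> E" "d \<le> \<mu> (centralizer G {inv (\<phi> h) \<otimes> h})" if "h \<in> carrier G" for h
    using someI_ex[of "\<lambda>x. x \<in> E \<and> d \<le> \<mu> (centralizer G {inv x \<otimes> h})"] ex[OF that] unfolding \<phi>_def by auto
  have \<phi>G: "\<phi> h \<in> carrier G" if "h \<in> carrier G" for h using \<phi>(1)[OF that] EG by blast
  have \<phi>_card: "finite (conj_class (inv (\<phi> h) \<otimes> h))" "card (conj_class (inv (\<phi> h) \<otimes> h)) \<le> nat \<lfloor>1 / d\<rfloor>"
    if "h \<in> carrier G" for h
    using card_conj_class_le[OF \<mu> _ \<open>0 < d\<close> \<phi>(2)[OF that]] \<phi>G[OF that] that by auto
  have \<phi>_fc: "inv (\<phi> h) \<otimes> h \<in> fc_center" if "h \<in> carrier G" for h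
    using \<phi>_card(1) \<phi>G that by (simp add: fc_center_def)
  note subF = subgroup_fc_center
  have F: "finite_index G fc_center"
  proof (rule finite_indexI[OF subF, of \<phi>])
    show "finite (\<phi> ` carrier G)" using \<phi>(1) finE by (meson finite_subset image_subsetI)
    fix x y assume xy: "x \<in> carrier G" "y \<in> carrier G" "\<phi> x = \<phi> y"
    have "inv (inv (\<phi> x) \<otimes> x) \<otimes> (inv (\<phi> y) \<otimes> y) \<in> fc_center"
      by (rule subgroup.m_closed[OF subF subgroup.m_inv_closed[OF subF]]) (rule \<phi>_fc[OF xy(1)] \<phi>_fc[OF xy(2)])+
    then show "inv x \<otimes> y \<in> fc_center" using xy \<phi>G[of y] by (simp add: group_simps)
  qed
  \<comment> \<open>Infinite classes have \<open>card\<close> 0 and add nothing to the sum. This is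
    harmless, since for \<open>h\<close> in \<open>fc_center\<close> the class of
    \<open>\<phi> h\<close> is shown to be finite.\<close>
  let ?M = "(\<Sum>x\<in>E. card (conj_class x)) * nat \<lfloor>1 / d\<rfloor>"
  have "card (conj_class h) \<le> ?M" if h: "h \<in> fc_center" for h
  proof -
    have hG: "h \<in> carrier G" using h by (simp add: fc_center_def)
    have "h \<otimes> inv (inv (\<phi> h) \<otimes> h) \<in> fc_center"
      by (rule subgroup.m_closed[OF subF h subgroup.m_inv_closed[OF subF \<phi>_fc[OF hG]]])
    then have fin: "finite (conj_class (\<phi> h))"
      using hG \<phi>G[OF hG] by (simp add: group_simps fc_center_def)
    let ?P = "conj_class (\<phi> h) \<times> conj_class (inv (\<phi> h) \<otimes> h)"
    have finP: "finite ?P" using fin \<phi>_card(1)[OF hG] by simp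
    have "conj_class h \<subseteq> (\<lambda>(u, v). u \<otimes> v) ` ?P"
      using conj_class_mult_subset[of "\<phi> h" "inv (\<phi> h) \<otimes> h"] hG \<phi>G[OF hG] by simp
    then have "card (conj_class h) \<le> card ?P"
      using finP by (meson card_image_le card_mono finite_imageI order_trans)
    also have "\<dots> = card (conj_class (\<phi> h)) * card (conj_class (inv (\<phi> h) \<otimes> h))"
      by (rule card_cartesian_product)
    also have "\<dots> \<le> ?M"
      using \<phi>_card(2)[OF hG] \<phi>(1)[OF hG] finE by (intro mult_le_mono member_le_sum) auto
    finally show ?thesis .
  qed
  then show thesis
    using finite_index_finite_derived_if_bounded_classes[OF F, of ?M] that
    by (auto simp: fc_center_def conj_class_def)
qed

section \<open>The degree of commutativity as an integral\<close>

text \<open>Off the carrier the slices of the commuting pairs are empty; the second branch makes the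
  integrands equal as functions, not only on the carrier.\<close>

lemma degree_comm_eq_mean_integral_centralizer:
  "degree_comm G \<mu> = mean_integral G \<mu> (\<lambda>g. if g \<in> carrier G then \<mu> (centralizer G {g}) else \<mu> {})"
proof -
  have "(\<lambda>g. \<mu> {h \<in> carrier G. (g, h) \<in> commuting_pairs G})
      = (\<lambda>g. if g \<in> carrier G then \<mu> (centralizer G {g}) else \<mu> {})"
    by (auto simp: commuting_pairs_def centralizer_def intro!: arg_cong[of _ _ \<mu>])
  then show ?thesis by (simp add: degree_comm_def product_mean_def)
qed

text \<open>By contraposition of the preceding criterion, the integrand exceeds each positive
  \<open>e\<close> only on a null set.\<close>

lemma degree_comm_eq_0:
  assumes \<mu>: "coset_correct_mean G \<mu>" and "\<not> finite_by_abelian_by_finite G"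
  shows "degree_comm G \<mu> = 0"
  unfolding degree_comm_eq_mean_integral_centralizer
proof (rule mean_integral_null[OF coset_correct_meanD(1)[OF \<mu>]])
  fix x assume "x \<in> carrier G"
  then show "0 \<le> (if x \<in> carrier G then \<mu> (centralizer G {x}) else \<mu> {}) \<and>
      (if x \<in> carrier G then \<mu> (centralizer G {x}) else \<mu> {}) \<le> 1"
    using fin_add_meanD(1,2)[OF coset_correct_meanD(1)[OF \<mu>], of "centralizer G {x}"]
    by (auto simp: centralizer_def)
next
  fix e :: real assume "e > 0"
  have "{x \<in> carrier G. e \<le> (if x \<in> carrier G then \<mu> (centralizer G {x}) else \<mu> {})}
      = {x \<in> carrier G. e \<le> \<mu> (centralizer G {x})}" by auto
  then show "\<mu> {x \<in> carrier G. e \<le> (if x \<in> carrier G then \<mu> (centralizer G {x}) else \<mu> {})} = 0"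
    using finite_index_finite_derived_if_centralizers_large[OF \<mu> \<open>e > 0\<close>] assms(2)
    by (auto simp: finite_by_abelian_by_finite_iff)
qed

end

section \<open>Level sets in finite-by-abelian-by-finite groups\<close>

definition cmts :: "('a, 'b) monoid_scheme \<Rightarrow> 'a set \<Rightarrow> 'a \<Rightarrow> 'a set" where
  "cmts G K g = cmt G g ` K"

text \<open>Rationality and independence of the mean are carried along together, so one
  \<open>q\<close> must serve for all means.\<close>

definition determined :: "('a, 'b) monoid_scheme \<Rightarrow> 'a set \<Rightarrow> bool" where
  "determined G A \<longleftrightarrow>
     A \<subseteq> carrier G \<and> (\<exists>q\<in>\<rat>. \<forall>\<nu>. coset_correct_mean G \<nu> \<longrightarrow> \<nu> A = q)"

lemma determined_empty: "determined G {}"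
  unfolding determined_def
  by (auto intro!: bexI[of _ 0] fin_add_mean_empty dest: coset_correct_meanD(1))

lemma determined_UN:
  assumes "finite I" "\<And>i. i \<in> I \<Longrightarrow> determined G (A i)" "disjoint_family_on A I"
  shows "determined G (\<Union>i\<in>I. A i)"
proof -
  have AG: "A i \<subseteq> carrier G" if "i \<in> I" for i
    using assms(2)[OF that] by (simp add: determined_def)
  have "\<forall>i\<in>I. \<exists>q. q \<in> \<rat> \<and> (\<forall>\<nu>. coset_correct_mean G \<nu> \<longrightarrow> \<nu> (A i) = q)"
    using assms(2) unfolding determined_def by blast
  from bchoice[OF this] obtain q where q: "\<forall>i\<in>I. q i \<in> \<rat> \<and> (\<forall>\<nu>. coset_correct_mean G \<nu> \<longrightarrow> \<nu> (A i) = q i)" ..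
  have "\<nu> (\<Union>i\<in>I. A i) = (\<Sum>i\<in>I. q i)" if "coset_correct_mean G \<nu>" for \<nu>
    using fin_add_mean_UN[OF coset_correct_meanD(1)[OF that] assms(1) AG assms(3)] q that by simp
  moreover have "(\<Sum>i\<in>I. q i) \<in> \<rat>" using q assms(1) by (intro Rats_sum) auto
  ultimately show ?thesis using AG unfolding determined_def by blast
qed

lemma determined_Diff:
  assumes "determined G A" "determined G B" "A \<subseteq> B"
  shows "determined G (B - A)"
proof -
  obtain p q where pq: "p \<in> \<rat>" "q \<in> \<rat>"
    "\<And>\<nu>. coset_correct_mean G \<nu> \<Longrightarrow> \<nu> A = p" "\<And>\<nu>. coset_correct_mean G \<nu> \<Longrightarrow> \<nu> B = q"
    using assms unfolding determined_def by blast
  have BG: "B \<subseteq> carrier G" using assms by (simp add: determined_def)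
  have "\<nu> (B - A) = q - p" if "coset_correct_mean G \<nu>" for \<nu>
    using fin_add_mean_Diff[OF coset_correct_meanD(1)[OF that] assms(3) BG] pq(3,4)[OF that] by simp
  moreover have "q - p \<in> \<rat>" using pq by simp
  ultimately show ?thesis using BG unfolding determined_def by blast
qed

context group
begin

lemma determined_l_coset: "subgroup H G \<Longrightarrow> g \<in> carrier G \<Longrightarrow> determined G (g <# H)"
  unfolding determined_def
  using coset_correct_meanD(2) inv_index_rat l_coset_subset_G subgroup.subset by metis

section \<open>Commutators as homomorphisms\<close>

text \<open>In general the first factor appears conjugated by \<open>inv k\<close>; commutation
  removes this.\<close>

lemma cmt_mult_left:
  assumes "g \<in> carrier G" "k \<in> carrier G" "l \<in> carrier G" and comm: "k \<in> centralizer G {cmt G g l}"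
  shows "cmt G (g \<otimes> k) l = cmt G g l \<otimes> cmt G k l"
proof -
  have "inv k \<in> centralizer G {cmt G g l}"
    using subgroup.m_inv_closed[OF subgroup_centralizer comm] assms by simp
  then have "inv k \<otimes> cmt G g l = cmt G g l \<otimes> inv k" by (simp add: centralizer_def)
  moreover have "cmt G (g \<otimes> k) l = inv k \<otimes> cmt G g l \<otimes> conj_by G l k"
    using assms by (simp add: group_simps)
  ultimately show ?thesis using assms by (simp add: m_assoc cmt_def)
qed

text \<open>In general the second factor appears conjugated by \<open>l\<close>; commutation removes
  this.\<close>

lemma cmt_mult_right:
  assumes "g \<in> carrier G" "l \<in> carrier G" "m \<in> carrier G" and comm: "l \<in> centralizer G {cmt G g m}"
  shows "cmt G g (l \<otimes> m) = cmt G g l \<otimes> cmt G g m"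
proof -
  have "inv l \<in> centralizer G {cmt G g m}"
    using subgroup.m_inv_closed[OF subgroup_centralizer comm] assms by simp
  then have comm': "cmt G g m \<otimes> inv l = inv l \<otimes> cmt G g m" by (simp add: centralizer_def)
  have "cmt G g (l \<otimes> m) = inv g \<otimes> l \<otimes> g \<otimes> (cmt G g m \<otimes> inv l)"
    using assms by (simp add: group_simps)
  also have "\<dots> = cmt G g l \<otimes> cmt G g m"
    unfolding comm' using assms by (simp add: group_simps)
  finally show ?thesis .
qed

text \<open>The values lie in \<open>N\<close>, which \<open>K\<close> centralizes, so
  \<open>cmt G g\<close> is a homomorphism on \<open>K\<close> and the set is its image.\<close>

lemma subgroup_cmts:
  assumes K: "subgroup K G" "K \<subseteq> centralizer G N" and g: "g \<in> carrier G" "cmts G K g \<subseteq> N"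
  shows "subgroup (cmts G K g) G"
proof -
  have KG: "K \<subseteq> carrier G" using K(1) subgroup.subset by blast
  have mult: "cmt G g (l \<otimes> m) = cmt G g l \<otimes> cmt G g m" if "l \<in> K" "m \<in> K" for l m
    using that K(2) g KG by (intro cmt_mult_right) (auto simp: centralizer_def cmts_def)
  have one: "cmt G g \<one> = \<one>" using g by (simp add: cmt_def conj_by_def)
  show ?thesis
  proof (rule subgroupI)
    show "cmts G K g \<subseteq> carrier G" using g KG by (auto simp: cmts_def)
    show "cmts G K g \<noteq> {}" using subgroup.one_closed[OF K(1)] by (auto simp: cmts_def)
  next
    fix n assume "n \<in> cmts G K g"
    then obtain l where l: "l \<in> K" "n = cmt G g l" by (auto simp: cmts_def)
    have lG: "l \<in> carrier G" and l': "inv l \<in> K" using l KG subgroup.m_inv_closed[OF K(1)] by auto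
    have "cmt G g (inv l) \<otimes> n = \<one>" using mult[OF l' l(1)] l lG one by simp
    then have "inv n = cmt G g (inv l)" using l lG g by (intro inv_equality) auto
    then show "inv n \<in> cmts G K g" using l' by (simp add: cmts_def)
  next
    fix n m assume "n \<in> cmts G K g" "m \<in> cmts G K g"
    then show "n \<otimes> m \<in> cmts G K g"
      using subgroup.m_closed[OF K(1)] by (auto simp: cmts_def simp flip: mult)
  qed
qed

text \<open>
  Since \<open>K\<close> commutes with \<open>N\<close>, the map \<^term>\<open>\<lambda>k. cmt G (g \<otimes> k) l\<close> is on \<open>K\<close> a translate of a homomorphism
  wherever it takes values in \<open>N\<close>.
\<close>

lemma determined_cmts_in_subgroups:
  assumes K: "subgroup K G" "K \<subseteq> centralizer G N" and a: "a \<in> carrier G"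
    and P: "\<And>l T. (l, T) \<in> P \<Longrightarrow> l \<in> carrier G \<and> subgroup T G \<and> T \<subseteq> N"
  shows "determined G {g \<in> a <# K. \<forall>(l, T)\<in>P. cmt G g l \<in> T}" (is "determined G ?B")
proof (cases "?B = {}")
  case True
  show ?thesis unfolding True by (rule determined_empty)
next
  case False
  \<comment> \<open>Any member serves as base point: the set turns out to be the coset of
    \<open>L\<close> through it.\<close>
  then obtain g where g: "g \<in> a <# K" "\<And>l T. (l, T) \<in> P \<Longrightarrow> cmt G g l \<in> T" by blast
  have KG: "K \<subseteq> carrier G" using K(1) subgroup.subset by blast
  have gG: "g \<in> carrier G" using g(1) a K(1) by (simp add: mem_l_coset_iff)
  define L where "L = {k \<in> K. \<forall>(l, T)\<in>P. cmt G k l \<in> T}"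
  have mult: "cmt G (h \<otimes> k) l = cmt G h l \<otimes> cmt G k l"
    if "k \<in> K" "h \<in> carrier G" "(l, T) \<in> P" "cmt G h l \<in> T" for h k l T
    using that P[OF that(3)] K(2) KG by (intro cmt_mult_left) (auto simp: centralizer_def)
  have one: "cmt G \<one> l = \<one>" if "l \<in> carrier G" for l using that by (simp add: cmt_def conj_by_def)
  have subL: "subgroup L G"
  proof (rule subgroupI)
    show "L \<subseteq> carrier G" using KG by (auto simp: L_def)
    have "\<one> \<in> L" using subgroup.one_closed[OF K(1)] P one subgroup.one_closed by (fastforce simp: L_def)
    then show "L \<noteq> {}" by blast
  next
    fix k assume k: "k \<in> L"
    then have kK: "k \<in> K" "inv k \<in> K" "k \<in> carrier G" using subgroup.m_inv_closed[OF K(1)] KG by (auto simp: L_def)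
    have "cmt G (inv k) l \<in> T" if lT: "(l, T) \<in> P" for l T
    proof -
      have l: "l \<in> carrier G" "subgroup T G" using P[OF lT] by auto
      have kT: "cmt G k l \<in> T" using k lT by (auto simp: L_def)
      have "cmt G k l \<otimes> cmt G (inv k) l = \<one>"
        using mult[OF kK(2,3) lT kT] kK one l by simp
      then have "cmt G (inv k) l = inv (cmt G k l)"
        using l kK by (intro inv_equality[symmetric] inv_comm[of "cmt G k l"]) auto
      then show ?thesis using subgroup.m_inv_closed[OF l(2) kT] by simp
    qed
    then show "inv k \<in> L" using kK by (auto simp: L_def)
  next
    fix k k' assume k: "k \<in> L" "k' \<in> L"
    have "cmt G (k \<otimes> k') l \<in> T" if lT: "(l, T) \<in> P" for l T
    proof -
      have "cmt G k l \<in> T" "cmt G k' l \<in> T" "k' \<in> K" "k \<in> carrier G"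
        using k lT KG by (auto simp: L_def)
      moreover have "subgroup T G" using P[OF lT] by simp
      ultimately show ?thesis using subgroup.m_closed[of T G] by (simp add: mult[OF _ _ lT])
    qed
    then show "k \<otimes> k' \<in> L" using k subgroup.m_closed[OF K(1)] by (auto simp: L_def)
  qed
  have "?B = g <# L"
  proof (rule Set.set_eqI)
    fix h
    have aK: "a <# K = g <# K" using l_repr_independence[OF g(1) a K(1)] .
    show "h \<in> ?B \<longleftrightarrow> h \<in> g <# L"
    proof (cases "h \<in> carrier G \<and> inv g \<otimes> h \<in> K")
      case True
      then have hG: "h \<in> carrier G" and hK: "inv g \<otimes> h \<in> K" by auto
      have "cmt G h l \<in> T \<longleftrightarrow> cmt G (inv g \<otimes> h) l \<in> T" if lT: "(l, T) \<in> P" for l T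
      proof -
        have l: "l \<in> carrier G" "subgroup T G" "cmt G g l \<in> T" using P[OF lT] g(2)[OF lT] by auto
        have eq: "cmt G h l = cmt G g l \<otimes> cmt G (inv g \<otimes> h) l"
          using mult[OF hK gG lT l(3)] gG hG by simp
        then have "cmt G (inv g \<otimes> h) l = inv (cmt G g l) \<otimes> cmt G h l" using l gG hG by simp
        with eq l show ?thesis by (metis subgroup.m_closed subgroup.m_inv_closed)
      qed
      then show ?thesis
        using hG hK gG subL K(1) unfolding aK by (auto simp: mem_l_coset_iff L_def)
    next
      case False
      then show ?thesis
        using gG subL K(1) unfolding aK by (auto simp: mem_l_coset_iff L_def)
    qed
  qed
  then show ?thesis using determined_l_coset[OF subL gG] by simp
qed

text \<open>Containment in \<open>T\<close> defines a determined set; the elements whose commutators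
  form a proper subgroup of \<open>T\<close> are removed by induction. \<open>S\<close> is separate
  from \<open>T\<close> because it stays fixed while \<open>T\<close> shrinks.\<close>

lemma determined_cmts_eq_l_coset:
  assumes K: "subgroup K G" "K \<subseteq> centralizer G N" and a: "a \<in> carrier G" and y: "y \<in> carrier G"
    and S: "subgroup S G" "S \<subseteq> N" and finN: "finite N"
  shows "subgroup T G \<Longrightarrow> T \<subseteq> N \<Longrightarrow> determined G {g \<in> a <# K. cmts G K g = T \<and> cmt G g y \<in> S}"
proof (induction "card T" arbitrary: T rule: less_induct)
  case less
  have KG: "K \<subseteq> carrier G" using K(1) subgroup.subset by blast
  have aKG: "a <# K \<subseteq> carrier G" using KG a l_coset_subset_G by blast
  let ?A = "\<lambda>T. {g \<in> a <# K. cmts G K g = T \<and> cmt G g y \<in> S}"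
  \<comment> \<open>Containment of the commutators in \<open>T\<close> is one condition for each
    \<open>l\<close> in \<open>K\<close>; the condition on \<open>y\<close> is added to
    these.\<close>
  let ?P = "insert (y, S) ((\<lambda>l. (l, T)) ` K)"
  let ?B = "{g \<in> a <# K. \<forall>(l, T)\<in>?P. cmt G g l \<in> T}"
  have B_eq: "?B = {g \<in> a <# K. cmts G K g \<subseteq> T \<and> cmt G g y \<in> S}"
    by (auto simp: cmts_def)
  let ?U = "{T'. subgroup T' G \<and> T' \<subset> T}"
  have finT: "finite T" using less.prems(2) finN finite_subset by blast
  have B: "determined G ?B"
    by (rule determined_cmts_in_subgroups[OF K a]) (use y S less.prems KG in auto)
  have "?U \<subseteq> Pow T" by blast
  then have "finite ?U" using finT by (simp add: finite_subset)
  moreover have "determined G (?A T')" if "T' \<in> ?U" for T'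
    using that less.prems(2) finT by (intro less.hyps) (auto intro: psubset_card_mono)
  moreover have "disjoint_family_on ?A ?U" by (auto simp: disjoint_family_on_def)
  ultimately have U: "determined G (\<Union>T'\<in>?U. ?A T')" by (rule determined_UN)
  let ?C = "{g \<in> a <# K. cmts G K g \<subseteq> T \<and> cmt G g y \<in> S}"
  have "?A T = ?C - (\<Union>T'\<in>?U. ?A T')"
  proof (intro equalityI subsetI)
    fix g assume "g \<in> ?C - (\<Union>T'\<in>?U. ?A T')"
    then have g: "g \<in> a <# K" "cmts G K g \<subseteq> T" "cmt G g y \<in> S" "cmts G K g \<notin> ?U"
      by blast+
    have "subgroup (cmts G K g) G" using subgroup_cmts[OF K] g(1,2) aKG less.prems(2) by blast
    then have "cmts G K g = T" using g(2,4) by blast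
    then show "g \<in> ?A T" using g(1,3) by blast
  qed blast
  moreover have "(\<Union>T'\<in>?U. ?A T') \<subseteq> ?C" by blast
  with U B have "determined G (?C - (\<Union>T'\<in>?U. ?A T'))"
    unfolding B_eq by (intro determined_Diff)
  ultimately show ?case by (simp only:)
qed

lemma determined_cmts_eq:
  assumes K: "finite_index G K" "K \<subseteq> centralizer G N" and y: "y \<in> carrier G" and finN: "finite N"
    and T: "subgroup T G" "T \<subseteq> N"
  shows "determined G {g \<in> carrier G. cmts G K g = T \<and> cmt G g y \<in> T}"
proof -
  note subK = finite_indexD(1)[OF K(1)]
  obtain R where R: "finite R" "R \<subseteq> carrier G" "\<And>x. x \<in> carrier G \<Longrightarrow> \<exists>!r. r \<in> R \<and> x \<in> r <# K"
    using finite_index_transversal[OF K(1)] by blast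
  have sub: "r <# K \<subseteq> carrier G" if "r \<in> R" for r
    using that R(2) l_coset_subset_G[OF finite_indexD(3)[OF K(1)]] by blast
  let ?A = "\<lambda>a. {g \<in> a <# K. cmts G K g = T \<and> cmt G g y \<in> T}"
  have "determined G (\<Union>a\<in>R. ?A a)"
  proof (rule determined_UN[OF R(1)])
    show "determined G (?A a)" if "a \<in> R" for a
      using that R(2) by (intro determined_cmts_eq_l_coset[OF subK K(2) _ y T finN T]) blast
    show "disjoint_family_on ?A R"
      using R(3) sub unfolding disjoint_family_on_def by blast
  qed
  moreover have "(\<Union>a\<in>R. ?A a) = (\<Union>a\<in>R. a <# K) \<inter> {g. cmts G K g = T \<and> cmt G g y \<in> T}"
    by blast
  moreover have "(\<Union>a\<in>R. a <# K) = carrier G"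
  proof
    show "(\<Union>a\<in>R. a <# K) \<subseteq> carrier G" using sub by (rule UN_least)
    show "carrier G \<subseteq> (\<Union>a\<in>R. a <# K)"
    proof
      fix x assume "x \<in> carrier G"
      from ex1_implies_ex[OF R(3)[OF this]] obtain r where "r \<in> R \<and> x \<in> r <# K" ..
      then show "x \<in> (\<Union>a\<in>R. a <# K)" by blast
    qed
  qed
  ultimately have "determined G (carrier G \<inter> {g. cmts G K g = T \<and> cmt G g y \<in> T})" by (simp only:)
  then show ?thesis by (simp only: Int_def mem_Collect_eq)
qed

section \<open>Measures of centralizers in terms of commutators\<close>

lemma inv_mult_mem_iff:
  assumes "subgroup H G" "x \<in> H" "z \<in> carrier G"
  shows "inv x \<otimes> z \<in> H \<longleftrightarrow> z \<in> H"
  using assms by (metis inv_cancel(2) subgroup.m_closed subgroup.m_inv_closed subgroup.mem_carrier)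

text \<open>The fibres of \<open>cmt G g\<close> on \<open>K\<close> are left cosets of the
  centralizer in \<open>K\<close>, so the index formula is read off by measuring
  \<open>K\<close>.\<close>

lemma inv_index_centralizer_times_card_cmts:
  assumes \<nu>: "coset_correct_mean G \<nu>" and K: "subgroup K G" and g: "g \<in> carrier G"
    and fin: "finite (cmts G K g)"
  shows "inv_index G (K \<inter> centralizer G {g}) * real (card (cmts G K g)) = inv_index G K"
proof -
  note m = coset_correct_meanD(1)[OF \<nu>]
  have KG: "K \<subseteq> carrier G" using K subgroup.subset by blast
  let ?C = "K \<inter> centralizer G {g}"
  have subC: "subgroup ?C G" using K g by (intro subgroups_Inter_pair subgroup_centralizer) auto
  let ?A = "\<lambda>t. {l \<in> K. cmt G g l = t}"
  have "\<nu> K = \<nu> (\<Union>t\<in>cmts G K g. ?A t)"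
    by (rule arg_cong[of _ _ \<nu>]) (auto simp: cmts_def)
  also have "\<dots> = (\<Sum>t\<in>cmts G K g. \<nu> (?A t))"
    using KG by (intro fin_add_mean_UN[OF m fin]) (auto simp: disjoint_family_on_def)
  also have "\<dots> = (\<Sum>t\<in>cmts G K g. inv_index G ?C)"
  proof (rule sum.cong[OF refl])
    fix t assume "t \<in> cmts G K g"
    then obtain k where k: "k \<in> K" "t = cmt G g k" by (auto simp: cmts_def)
    have kG: "k \<in> carrier G" using k KG by blast
    have "?A t = k <# ?C"
    proof (rule Set.set_eqI)
      fix l
      show "l \<in> ?A t \<longleftrightarrow> l \<in> k <# ?C"
      proof (cases "l \<in> carrier G")
        case True
        have "cmt G g l = t \<longleftrightarrow> conj_by G k g = conj_by G l g"
          using k kG g True by (auto simp: cmt_def)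
        also have "\<dots> \<longleftrightarrow> inv k \<otimes> l \<in> centralizer G {g}" by (rule conj_by_eq_iff[OF kG True g])
        finally have 1: "cmt G g l = t \<longleftrightarrow> inv k \<otimes> l \<in> centralizer G {g}" .
        with inv_mult_mem_iff[OF K k(1) True] show ?thesis
          using mem_l_coset_iff[OF subC kG] True by auto
      next
        case False
        then show ?thesis using mem_l_coset_iff[OF subC kG] KG by auto
      qed
    qed
    then show "\<nu> (?A t) = inv_index G ?C" using coset_correct_meanD(2)[OF \<nu> subC kG] by simp
  qed
  finally show ?thesis using coset_correct_mean_subgroup[OF \<nu> K] by (simp add: mult.commute)
qed

text \<open>An element \<open>y \<otimes> l\<close> centralizes \<open>g\<close> exactly when
  \<open>inv y\<close> and \<open>l\<close> have the same commutator with \<open>g\<close>; the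
  intersection is thus empty or a coset.\<close>

lemma mean_centralizer_Int_l_coset:
  assumes \<nu>: "coset_correct_mean G \<nu>" and K: "subgroup K G" and g: "g \<in> carrier G" and y: "y \<in> carrier G"
  shows "\<nu> (centralizer G {g} \<inter> (y <# K)) =
    (if cmt G g (inv y) \<in> cmts G K g then inv_index G (K \<inter> centralizer G {g}) else 0)"
proof -
  have KG: "K \<subseteq> carrier G" using K subgroup.subset by blast
  let ?Z = "centralizer G {g}"
  let ?C = "K \<inter> ?Z"
  have subZ: "subgroup ?Z G" using g by (intro subgroup_centralizer) auto
  have subC: "subgroup ?C G" using K subZ by (rule subgroups_Inter_pair)
  have iff: "y \<otimes> l \<in> ?Z \<longleftrightarrow> cmt G g (inv y) = cmt G g l" if "l \<in> K" for l
  proof -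
    have l: "l \<in> carrier G" using that KG by blast
    have "cmt G g (inv y) = cmt G g l \<longleftrightarrow> conj_by G (inv y) g = conj_by G l g"
      using l y g by (simp add: cmt_def)
    then show ?thesis using conj_by_eq_iff[of "inv y" l g] l y g by simp
  qed
  show ?thesis
  proof (cases "cmt G g (inv y) \<in> cmts G K g")
    case True
    then obtain l where l: "l \<in> K" "cmt G g (inv y) = cmt G g l" by (auto simp: cmts_def)
    let ?x = "y \<otimes> l"
    have x: "?x \<in> ?Z" "?x \<in> y <# K" "?x \<in> carrier G"
      using iff[OF l(1)] l y KG by (auto simp: l_coset_def)
    have "y <# K = ?x <# K" using l_repr_independence[OF x(2) y K] .
    then have "?Z \<inter> (y <# K) = ?x <# ?C"
      using inv_mult_mem_iff[OF subZ x(1)] mem_l_coset_iff[OF subC x(3)] mem_l_coset_iff[OF K x(3)]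
        centralizerD(1) by blast
    then show ?thesis using True coset_correct_meanD(2)[OF \<nu> subC x(3)] by simp
  next
    case False
    then have "?Z \<inter> (y <# K) = {}" using iff by (fastforce simp: l_coset_def cmts_def)
    then show ?thesis using False fin_add_mean_empty[OF coset_correct_meanD(1)[OF \<nu>]] by simp
  qed
qed

text \<open>
  Every element with finite conjugacy class is a representative \<open>a\<close> from a finite set times an
  element \<open>h\<close> of \<open>H\<close>; requiring \<open>K\<close> to commute with the representatives leaves the commutators of \<open>h\<close>.
\<close>

lemma finite_by_abelian_by_finite_commutators:
  assumes "finite_by_abelian_by_finite G"
  obtains K N where "finite_index G K" "finite N" "N \<subseteq> carrier G" "K \<subseteq> centralizer G N" "K \<subseteq> fc_center"
    "\<And>g. g \<in> fc_center \<Longrightarrow> cmts G K g \<subseteq> N"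
proof -
  obtain H where H: "finite_index G H" "finite (derived G H)"
    using assms by (auto simp: finite_by_abelian_by_finite_iff)
  define N where "N = derived G H"
  note subH = finite_indexD(1)[OF H(1)]
  note HG = finite_indexD(3)[OF H(1)]
  have subN: "subgroup N G" unfolding N_def by (rule derived_is_subgroup[OF HG])
  have NH: "N \<subseteq> H" unfolding N_def by (rule derived_incl[OF subset_refl subH])
  have cmtN: "cmt G h l \<in> N" if "h \<in> H" "l \<in> H" for h l
  proof -
    have "h \<in> carrier G" "l \<in> carrier G" using that HG by auto
    then have "cmt G h l = inv h \<otimes> l \<otimes> inv (inv h) \<otimes> inv l" by (simp add: group_simps)
    moreover have "inv h \<in> H" using subgroup.m_inv_closed[OF subH that(1)] .
    ultimately have "cmt G h l \<in> derived_set G H" using that(2) by blast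
    then show ?thesis unfolding N_def derived_def by (rule generate.incl)
  qed
  obtain R where R: "finite R" "R \<subseteq> carrier G" "\<And>x. x \<in> carrier G \<Longrightarrow> \<exists>!r. r \<in> R \<and> x \<in> r <# H"
    using finite_index_transversal[OF H(1)] by blast
  have dec: "\<exists>r\<in>R. \<exists>h\<in>H. x = r \<otimes> h" if "x \<in> carrier G" for x
    using R(3)[OF that] by (auto simp: l_coset_def)
  have H_fc: "H \<subseteq> fc_center"
  proof
    fix h assume h: "h \<in> H"
    \<comment> \<open>Conjugation by the part in \<open>H\<close> moves \<open>h\<close> only within
      \<open>h\<close> times \<open>N\<close>, leaving finitely many representatives to
      apply.\<close>
    have "conj_class h \<subseteq> (\<Union>r\<in>R. conj_by G r ` (\<lambda>n. h \<otimes> n) ` N)"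
    proof
      fix z assume "z \<in> conj_class h"
      then obtain x where x: "x \<in> carrier G" "z = conj_by G x h" by (auto simp: conj_class_def)
      obtain r k where rk: "r \<in> R" "k \<in> H" "x = r \<otimes> k" using dec[OF x(1)] by blast
      have G: "h \<in> carrier G" "r \<in> carrier G" "k \<in> carrier G" using h rk HG R(2) by auto
      have "z = conj_by G r (h \<otimes> cmt G h k)"
        unfolding x(2) rk(3) using G by (simp add: conj_by_mult(1) conj_by_eq_cmt[OF G(3,1)])
      then show "z \<in> (\<Union>r\<in>R. conj_by G r ` (\<lambda>n. h \<otimes> n) ` N)" using rk(1) cmtN[OF h rk(2)] by blast
    qed
    then have "finite (conj_class h)"
      by (rule finite_subset) (use R(1) H(2) in \<open>simp add: N_def\<close>)
    then show "h \<in> fc_center" using h HG by (auto simp: fc_center_def)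
  qed
  \<comment> \<open>Only cosets that meet \<open>fc_center\<close> matter, and their representatives
    are rechosen inside it so that their centralizer has finite index.\<close>
  define R' where "R' = {r \<in> R. \<exists>a. a \<in> fc_center \<and> a \<in> r <# H}"
  have "\<forall>r\<in>R'. \<exists>a. a \<in> fc_center \<and> a \<in> r <# H" by (auto simp: R'_def)
  from bchoice[OF this] obtain s where s: "\<forall>r\<in>R'. s r \<in> fc_center \<and> s r \<in> r <# H" ..
  define K where "K = H \<inter> (centralizer G N \<inter> centralizer G (s ` R'))"
  have "finite_index G K"
    unfolding K_def
    by (intro finite_index_Int H(1) finite_index_centralizer_fc)
      (use H(2) R(1) s NH H_fc in \<open>auto simp: N_def R'_def\<close>)
  moreover have "cmts G K g \<subseteq> N" if g: "g \<in> fc_center" for g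
  proof
    fix c assume "c \<in> cmts G K g"
    then obtain l where l: "l \<in> K" "c = cmt G g l" by (auto simp: cmts_def)
    have lG: "l \<in> carrier G" and lH: "l \<in> H" using l HG by (auto simp: K_def)
    have gG: "g \<in> carrier G" using g by (simp add: fc_center_def)
    obtain r where r: "r \<in> R" "g \<in> r <# H" using R(3)[OF gG] by blast
    then have r': "r \<in> R'" using g by (auto simp: R'_def)
    have rG: "r \<in> carrier G" using r R(2) by blast
    have sr: "s r \<in> fc_center" "s r \<in> r <# H" using s r' by auto
    have srG: "s r \<in> carrier G" using sr(1) by (simp add: fc_center_def)
    have "s r <# H = r <# H" using l_repr_independence[OF sr(2) rG subH] by simp
    then have h: "inv (s r) \<otimes> g \<in> H" using r(2) srG subH by (simp add: mem_l_coset_iff flip: \<open>s r <# H = r <# H\<close>)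
    let ?h = "inv (s r) \<otimes> g"
    have "l \<in> centralizer G {s r}" using l(1) r' by (auto simp: K_def centralizer_def)
    then have conj: "conj_by G l (s r) = s r" using srG by (simp add: mem_centralizer_singleton_iff)
    \<comment> \<open>As \<open>l\<close> fixes \<open>s r\<close>, the commutators of
      \<open>g\<close> and of \<open>?h\<close> with \<open>l\<close> agree.\<close>
    have "conj_by G l g = conj_by G l (s r \<otimes> ?h)" using srG gG by simp
    also have "\<dots> = s r \<otimes> conj_by G l ?h" using srG gG lG conj by (simp add: conj_by_mult(2) del: inv_cancel)
    finally have "c = cmt G ?h l" unfolding l(2) using srG gG lG by (simp add: cmt_def inv_mult_group m_assoc)
    then show "c \<in> N" using cmtN[OF h lH] by simp
  qed
  moreover have "finite N" "N \<subseteq> carrier G" using H(2) NH HG by (auto simp: N_def)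
  moreover have "K \<subseteq> centralizer G N" "K \<subseteq> fc_center" using H_fc by (auto simp: K_def)
  ultimately show thesis by (intro that[of K N])
qed

text \<open>Cutting the centralizer along the cosets of \<open>K\<close> expresses the integrand as
  a combination of indicators of determined sets, with coefficients independent of the mean.\<close>

lemma mean_centralizer_eq_sum:
  assumes \<nu>: "coset_correct_mean G \<nu>" and K: "finite_index G K" "K \<subseteq> centralizer G N"
    and N: "finite N" and cmtN: "\<And>g. g \<in> fc_center \<Longrightarrow> cmts G K g \<subseteq> N"
    and R: "finite R" "R \<subseteq> carrier G" "\<And>x. x \<in> carrier G \<Longrightarrow> \<exists>!r. r \<in> R \<and> x \<in> r <# K"
    and g: "g \<in> carrier G"
  shows "\<nu> (centralizer G {g}) =
    (\<Sum>(y, T)\<in>R \<times> {T. subgroup T G \<and> T \<subseteq> N}. inv_index G K / real (card T) *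
      indicator {g \<in> carrier G. cmts G K g = T \<and> cmt G g (inv y) \<in> T} g)"
proof -
  note m = coset_correct_meanD(1)[OF \<nu>]
  note subK = finite_indexD(1)[OF K(1)]
  let ?Z = "centralizer G {g}"
  let ?S = "{T. subgroup T G \<and> T \<subseteq> N}"
  let ?T = "cmts G K g"
  have ZG: "?Z \<subseteq> carrier G" by (auto simp: centralizer_def)
  have finS: "finite ?S" using N by (rule finite_subset[rotated, OF finite_Pow_iff[THEN iffD2]]) blast
  show ?thesis
  proof (cases "?T \<subseteq> N")
    case True
    have finT: "finite ?T" using True N finite_subset by blast
    have subT: "subgroup ?T G" by (rule subgroup_cmts[OF subK K(2) g True])
    have "card ?T \<noteq> 0" using finT subgroup.one_closed[OF subT] by auto
    then have idx: "inv_index G (K \<inter> ?Z) = inv_index G K / real (card ?T)"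
      using inv_index_centralizer_times_card_cmts[OF \<nu> subK g finT] by (simp add: field_simps)
    have "?Z = (\<Union>y\<in>R. ?Z \<inter> (y <# K))"
    proof (intro equalityI subsetI)
      fix x assume x: "x \<in> ?Z"
      then have "x \<in> carrier G" using ZG by blast
      from ex1_implies_ex[OF R(3)[OF this]] obtain r where "r \<in> R \<and> x \<in> r <# K" ..
      with x show "x \<in> (\<Union>y\<in>R. ?Z \<inter> (y <# K))" by blast
    qed blast
    then have "\<nu> ?Z = \<nu> (\<Union>y\<in>R. ?Z \<inter> (y <# K))" by (rule arg_cong)
    also have "\<dots> = (\<Sum>y\<in>R. \<nu> (?Z \<inter> (y <# K)))"
    proof (rule fin_add_mean_UN[OF m R(1)])
      show "disjoint_family_on (\<lambda>y. ?Z \<inter> (y <# K)) R"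
        unfolding disjoint_family_on_def
      proof (intro ballI impI equals0I)
        fix y z x assume "y \<in> R" "z \<in> R" "y \<noteq> z" "x \<in> ?Z \<inter> (y <# K) \<inter> (?Z \<inter> (z <# K))"
        moreover from this have "x \<in> carrier G" using ZG by blast
        ultimately show False using R(3) by blast
      qed
    qed (use ZG in blast)
    \<comment> \<open>Among all candidates \<open>T\<close>, only the actual set of commutators of
      \<open>g\<close> contributes.\<close>
    also have "\<dots> = (\<Sum>y\<in>R. \<Sum>T\<in>?S. if T = ?T then
        inv_index G K / real (card T) * of_bool (cmt G g (inv y) \<in> T) else 0)"
    proof (rule sum.cong[OF refl])
      fix y assume "y \<in> R"
      then have y: "y \<in> carrier G" using R(2) by blast
      show "\<nu> (?Z \<inter> (y <# K)) = (\<Sum>T\<in>?S. if T = ?T then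
          inv_index G K / real (card T) * of_bool (cmt G g (inv y) \<in> T) else 0)"
        using finS subT True by (simp add: mean_centralizer_Int_l_coset[OF \<nu> subK g y] idx)
    qed
    also have "\<dots> = (\<Sum>y\<in>R. \<Sum>T\<in>?S. inv_index G K / real (card T) *
      indicator {g \<in> carrier G. cmts G K g = T \<and> cmt G g (inv y) \<in> T} g)"
      using g by (intro sum.cong refl) (auto simp: indicator_def)
    finally show ?thesis by (simp only: sum.cartesian_product)
  next
    case False
    then have "g \<notin> fc_center" using cmtN by blast
    then have "\<nu> ?Z = 0"
      using centralizer_singleton_pos_iff[OF \<nu> g] fin_add_meanD(1)[OF m ZG] by simp
    also have "\<dots> = (\<Sum>(y, T)\<in>R \<times> ?S. inv_index G K / real (card T) *
      indicator {g \<in> carrier G. cmts G K g = T \<and> cmt G g (inv y) \<in> T} g)"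
      by (rule sum.neutral[symmetric]) (use False in \<open>auto simp: indicator_def\<close>)
    finally show ?thesis .
  qed
qed

section \<open>Rationality, independence and positivity\<close>

text \<open>The sum \<open>r\<close> is formed before any mean is fixed. Positivity is stated for a
  given mean because it is proved by integrating against it.\<close>

lemma degree_comm_constant:
  assumes faf: "finite_by_abelian_by_finite G"
  obtains r where "r \<in> \<rat>" "\<And>\<nu>. coset_correct_mean G \<nu> \<Longrightarrow> degree_comm G \<nu> = r \<and> 0 < r"
proof -
  obtain K N where K: "finite_index G K" and N: "finite N" "N \<subseteq> carrier G"
    and KN: "K \<subseteq> centralizer G N" "K \<subseteq> fc_center" and cmtN: "\<And>g. g \<in> fc_center \<Longrightarrow> cmts G K g \<subseteq> N"
    using finite_by_abelian_by_finite_commutators[OF faf] by blast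
  note subK = finite_indexD(1)[OF K]
  note KG = finite_indexD(3)[OF K]
  obtain R where R: "finite R" "R \<subseteq> carrier G" "\<And>x. x \<in> carrier G \<Longrightarrow> \<exists>!r. r \<in> R \<and> x \<in> r <# K"
    using finite_index_transversal[OF K] by blast
  define J where "J = R \<times> {T. subgroup T G \<and> T \<subseteq> N}"
  define A where "A = (\<lambda>(y, T). {g \<in> carrier G. cmts G K g = T \<and> cmt G g (inv y) \<in> T})"
  define c where "c = (\<lambda>(y :: 'a, T :: 'a set). inv_index G K / real (card T))"
  have "finite {T. subgroup T G \<and> T \<subseteq> N}"
    using N(1) by (rule finite_subset[rotated, OF finite_Pow_iff[THEN iffD2]]) blast
  then have finJ: "finite J" using R(1) by (simp add: J_def)
  have detA: "determined G (A j)" if "j \<in> J" for j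
    using that R(2) determined_cmts_eq[OF K KN(1) _ N(1)]
    by (auto simp: J_def A_def subset_iff)
  have AG: "A j \<subseteq> carrier G" for j by (auto simp: A_def split: prod.splits)
  have "\<forall>j\<in>J. \<exists>q. q \<in> \<rat> \<and> (\<forall>\<nu>. coset_correct_mean G \<nu> \<longrightarrow> \<nu> (A j) = q)"
    using detA unfolding determined_def by blast
  from bchoice[OF this] obtain q
    where q: "\<forall>j\<in>J. q j \<in> \<rat> \<and> (\<forall>\<nu>. coset_correct_mean G \<nu> \<longrightarrow> \<nu> (A j) = q j)" ..
  let ?r = "\<Sum>j\<in>J. c j * q j"
  have "?r \<in> \<rat>"
    using q inv_index_rat by (intro Rats_sum Rats_mult) (auto simp: c_def split: prod.splits)
  moreover have "degree_comm G \<nu> = ?r \<and> 0 < ?r" if \<nu>: "coset_correct_mean G \<nu>" for \<nu>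
  proof -
    note m = coset_correct_meanD(1)[OF \<nu>]
    let ?f = "\<lambda>g. if g \<in> carrier G then \<nu> (centralizer G {g}) else \<nu> {}"
    have f: "?f g = (\<Sum>j\<in>J. c j * indicator (A j) g)" if "g \<in> carrier G" for g
      using mean_centralizer_eq_sum[OF \<nu> K KN(1) N(1) cmtN R that] that
      by (simp add: J_def c_def A_def case_prod_unfold)
    have r: "?r = (\<Sum>j\<in>J. c j * \<nu> (A j))" using q \<nu> by simp
    have deg: "degree_comm G \<nu> = ?r"
      unfolding degree_comm_eq_mean_integral_centralizer r
      by (rule mean_integral_simple[OF m finJ AG f])
    \<comment> \<open>Positivity compares two integrals, so a concrete monotone functional is fixed;
      its value at the integrand is again \<open>?r\<close>.\<close>
    let ?I = "lower_integral G \<nu>"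
    have I: "integral_functional G \<nu> ?I" by (rule integral_functional_lower_integral[OF m])
    note D = integral_functionalD[OF I]
    \<comment> \<open>A lower bound for the integrand on \<open>K\<close>, where commutator sets
      have at most \<open>card N\<close> elements; the added 1 keeps the denominator positive in any
      case.\<close>
    let ?e = "inv_index G K / (real (card N) + 1)"
    have pos: "0 < inv_index G K" using inv_index_pos_iff[OF subK] K by simp
    have "0 < ?e * \<nu> K" using pos coset_correct_mean_subgroup[OF \<nu> subK] by (simp add: add_nonneg_pos)
    also have "\<dots> = ?I (\<lambda>g. ?e * indicator K g)"
      by (simp only: D(2)[OF bounded_fun_on_indicator] D(4)[OF KG])
    also have "\<dots> \<le> ?I ?f"
    proof (rule D(3))
      show "bounded_fun_on G (\<lambda>g. ?e * indicator K g)"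
        by (intro bounded_fun_on_cmult bounded_fun_on_indicator)
      have cent: "centralizer G {g} \<subseteq> carrier G" for g by (auto simp: centralizer_def)
      show "bounded_fun_on G ?f"
        using fin_add_meanD(1,2)[OF m cent] by (intro bounded_fun_onI[of _ _ 1]) auto
      fix g assume g: "g \<in> carrier G"
      show "?e * indicator K g \<le> ?f g"
      proof (cases "g \<in> K")
        case True
        then have sub: "cmts G K g \<subseteq> N" using KN(2) cmtN by blast
        have fin: "finite (cmts G K g)" using sub N(1) finite_subset by blast
        have "real (card (cmts G K g)) \<le> real (card N) + 1" using card_mono[OF N(1) sub] by simp
        then have "inv_index G K \<le> inv_index G (K \<inter> centralizer G {g}) * (real (card N) + 1)"
          using inv_index_centralizer_times_card_cmts[OF \<nu> subK g fin]
          by (metis inv_index_nonneg mult_left_mono)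
        then have "?e \<le> inv_index G (K \<inter> centralizer G {g})"
          by (simp add: divide_le_eq add_nonneg_pos)
        also have "\<dots> = \<nu> (K \<inter> centralizer G {g})"
          using g subK by (intro coset_correct_mean_subgroup[OF \<nu>, symmetric] subgroups_Inter_pair subgroup_centralizer) auto
        also have "\<dots> \<le> \<nu> (centralizer G {g})" by (rule fin_add_mean_mono[OF m Int_lower2 cent])
        finally show ?thesis using True g by simp
      next
        case False
        then show ?thesis using g fin_add_meanD(1)[OF m cent] by simp
      qed
    qed
    also have "\<dots> = ?r"
      unfolding r by (rule integral_functional_simple[OF I finJ AG f])
    finally show ?thesis using deg by simp
  qed
  ultimately show thesis by (rule that)
qed

end

theorem theorem1p4:
  fixes G :: "('a, 'b) monoid_scheme" and \<mu> :: "'a set \<Rightarrow> real"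
  assumes "group G"
    and "coset_correct_mean G \<mu>"
  shows "(degree_comm G \<mu> > 0 \<longleftrightarrow> finite_by_abelian_by_finite G) \<and>
    (\<forall>\<nu>. coset_correct_mean G \<nu> \<longrightarrow> degree_comm G \<nu> = degree_comm G \<mu>) \<and>
    degree_comm_ccm G = degree_comm G \<mu> \<and>
    degree_comm_ccm G \<in> \<rat>"
proof -
  interpret group G by fact
  \<comment> \<open>The common value is the positive rational just found or, outside the
    finite-by-abelian-by-finite case, 0.\<close>
  obtain r where r: "r \<in> \<rat>" "\<And>\<nu>. coset_correct_mean G \<nu> \<Longrightarrow> degree_comm G \<nu> = r"
    and pos: "0 < r \<longleftrightarrow> finite_by_abelian_by_finite G"
  proof (cases "finite_by_abelian_by_finite G")
    case True
    then obtain r where "r \<in> \<rat>" "\<And>\<nu>. coset_correct_mean G \<nu> \<Longrightarrow> degree_comm G \<nu> = r \<and> 0 < r"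
      using degree_comm_constant by blast
    then show thesis using True assms(2) by (intro that[of r]) auto
  next
    case False
    then show thesis using degree_comm_eq_0 by (intro that[of 0]) auto
  qed
  have "degree_comm_ccm G = r"
    unfolding degree_comm_ccm_def using r(2) assms(2) by (intro the_equality) auto
  then show ?thesis using r pos assms(2) by simp
qed

end
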